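(* Let $\bar x\in\mathbb{R}^n$, $r>0$, $X=\mathbb{B}(\bar x,r)$, and let $f:X\to\mathbb{R}$ be continuously differentiable with $\|\nabla f(x)-\nabla f(y)\|\le L\|x-y\|$ for all $x,y\in X$, where $L>0$. Let $\bar x$ be a local minimizer of $f$ and let $f$ satisfy the PLK condition at $\bar x$ with a desingularizing function $\psi$. Let $\nu\in(0,1)$ and $\{\beta_k\},\{\gamma_k\}\subset[0,\infty)$ with $\bar\beta=\sup_k\beta_k\in[0,\sqrt{1-\nu})$ and $\bar\delta=\sup_k|\beta_k-\gamma_k|<\infty$. Then there exist $\xi\in(0,r]$ and $T>0$ such that for any initial points $x^0=x^1\in\mathbb{B}(\bar x,\xi)$, any $\tau_1\in(0,T]$ and any $\tau_2\in\big[0,\frac{\nu}{L(\nu+1)}\big]$, the sequence $\{x^k\}$ generated by sharpness-aware minimization with momentum (SAMm, see context), provided that $\nabla f(x^k_{\rm ex})\ne0$ for all $k\in\mathbb{N}$, has the following properties. (i) The sequences $\{x^k\},\{x^k_{\rm in}\},\{x^k_{\rm ex}\}$ stay in $\mathbb{B}(\bar x,r)$ and converge to some local minimizer $\tilde x\in\mathbb{B}(\bar x,r)$ of $f$ with $f(\tilde x)=f(\bar x)$. (ii) If $\psi(t)=Mt^{1-q}$ for some $M>0$ and $q\in(0,1)$, then as $k\to\infty$: - for $q=1/2$, the sequences $\{x^k\},\{\nabla f(x^k)\},\{f(x^k)\}$ converge linearly to $\tilde x$, $0$, $f(\tilde x)$, respectively; - for $q\in(1/2,1)$, $$\|x^k-\tilde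 x\|=\mathcal{O}\big(k^{-\frac{1-q}{2q-1}}\big),\quad \|\nabla f(x^k)\|=\mathcal{O}\big(k^{-\frac{1-q}{2q-1}}\big),\quad f(x^k)-f(\tilde x)=\mathcal{O}\big(k^{-\frac{2-2q}{2q-1}}\big).$$
   Context: $\|\cdot\|$ is the Euclidean norm, $\mathbb{B}(\bar x,r)$ is the open ball, $\mathbb{N}=\{1,2,\dots\}$. SAMm: given $x^0=x^1\in X$, $\{\beta_k\},\{\gamma_k\}\subset[0,\infty)$ with $\bar\beta:=\sup_k\beta_k<1$ and $\bar\delta:=\sup_k|\beta_k-\gamma_k|<\infty$, and stepsizes $\tau_1,\tau_2$, for each $k\ge1$ put $x^k_{\rm in}:=x^k+\beta_k(x^k-x^{k-1})$, $x^k_{\rm ex}:=x^k+\gamma_k(x^k-x^{k-1})$, $x^{k+1}:=x^k_{\rm in}-\tau_1\nabla f\big(x^k_{\rm ex}+\tau_2\nabla f(x^k_{\rm ex})\big)$. Convention: for the recursion to make sense before one knows that its points lie in $X$, $\nabla f$ outside $X$ is understood as an arbitrary fixed extension of $\nabla f$ to $\mathbb{R}^n$. PLK (Polyak-Łojasiewicz-Kurdyka) condition for a $C^1$ function $f$ at $\bar x$ with desingularizing function $\varphi$: there are $\eta\in(0,\infty]$, a neighborhood $U\subset X$ of $\bar x$ and a concave function $\varphi:[0,\eta)\to[0,\infty)$ such that $\varphi(0)=0$, $\varphi$ is $C^1$ on $(0,\eta)$, $\varphi'>0$ on $(0,\eta)$, and $\varphi'(f(x)-f(\bar x))\|\nabla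 f(x)\|\ge1$ for all $x\in U$ with $f(\bar x)<f(x)<f(\bar x)+\eta$. A sequence $\{u^k\}$ converges linearly to $u$ if $\|u^k-u\|=\mathcal{O}(\mu^k)$ for some $\mu\in(0,1)$ (R-linear convergence). *)

theory Defs
  imports "HOL-Analysis.Analysis" "HOL-Library.Landau_Symbols"
begin

definition local_minimizer :: "'a::metric_space set \<Rightarrow> ('a \<Rightarrow> real) \<Rightarrow> 'a \<Rightarrow> bool" where
  "local_minimizer X f x \<longleftrightarrow> x \<in> X \<and> (\<exists>e>0. \<forall>y \<in> X \<inter> ball x e. f x \<le> f y)"

text \<open>The PLK condition at \<open>xbar\<close> for a \<open>C\<^sup>1\<close> function \<open>f\<close> on \<open>X\<close> with gradient \<open>g\<close>
  (used only on \<open>X\<close>). The right end point \<open>\<eta>\<close> of the domain \<open>[0, \<eta>)\<close> of the desingularizing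
  function \<open>\<phi>\<close> is a parameter, since hypotheses on \<open>\<phi>\<close> can only concern its values on that
  domain. Continuity of \<open>\<phi>\<close> at \<open>0\<close> is not required.\<close>

definition plk_condition ::
  "'a::real_inner set \<Rightarrow> ('a \<Rightarrow> real) \<Rightarrow> ('a \<Rightarrow> 'a) \<Rightarrow> 'a \<Rightarrow> ereal \<Rightarrow> (real \<Rightarrow> real) \<Rightarrow> bool" where
  "plk_condition X f g xbar \<eta> \<phi> \<longleftrightarrow>
     0 < \<eta> \<and>
     (\<forall>t. 0 \<le> t \<and> ereal t < \<eta> \<longrightarrow> 0 \<le> \<phi> t) \<and>
     concave_on {t. 0 \<le> t \<and> ereal t < \<eta>} \<phi> \<and>
     \<phi> 0 = 0 \<and>
     \<phi> C1_differentiable_on {t. 0 < t \<and> ereal t < \<eta>} \<and>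
     (\<forall>t. 0 < t \<and> ereal t < \<eta> \<longrightarrow> 0 < deriv \<phi> t) \<and>
     (\<exists>U. U \<subseteq> X \<and> xbar \<in> interior U \<and>
        (\<forall>x\<in>U. f xbar < f x \<and> ereal (f x) < ereal (f xbar) + \<eta> \<longrightarrow>
           1 \<le> deriv \<phi> (f x - f xbar) * norm (g x)))"

text \<open>With coefficients \<open>\<beta>\<close> this is the point \<open>x\<^sub>i\<^sub>n\<close> of step \<open>k \<ge> 1\<close>, with coefficients
  \<open>\<gamma>\<close> the point \<open>x\<^sub>e\<^sub>x\<close>. The index \<open>k = 0\<close> is never used.\<close>

definition extrapolate :: "(nat \<Rightarrow> real) \<Rightarrow> (nat \<Rightarrow> 'a::real_vector) \<Rightarrow> nat \<Rightarrow> 'a" where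
  "extrapolate c x k = x k + c k *\<^sub>R (x k - x (k - 1))"

definition samm_sequence ::
  "('a::real_vector \<Rightarrow> 'a) \<Rightarrow> (nat \<Rightarrow> real) \<Rightarrow> (nat \<Rightarrow> real) \<Rightarrow> real \<Rightarrow> real \<Rightarrow> (nat \<Rightarrow> 'a) \<Rightarrow> bool" where
  "samm_sequence g \<beta> \<gamma> \<tau>1 \<tau>2 x \<longleftrightarrow>
     x 0 = x 1 \<and>
     (\<forall>k\<ge>1. x (k + 1) = extrapolate \<beta> x k
        - \<tau>1 *\<^sub>R g (extrapolate \<gamma> x k + \<tau>2 *\<^sub>R g (extrapolate \<gamma> x k)))"

text \<open>R-linear convergence.\<close>

definition converges_linearly :: "(nat \<Rightarrow> 'a::real_normed_vector) \<Rightarrow> 'a \<Rightarrow> bool" where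
  "converges_linearly u l \<longleftrightarrow> (\<exists>\<mu>\<in>{0<..<1}. (\<lambda>k. norm (u k - l)) \<in> O(\<lambda>k. \<mu> ^ k))"

end

theory Submission imports Defs
begin

text \<open>Write \<open>p k = x k - x (k - 1)\<close> and \<open>w k = norm (p k) + norm (p (k + 1))\<close>. Since \<open>\<tau>2\<close> is small, the
  step direction differs from the gradient at \<open>x\<^sub>e\<^sub>x\<close> by a relative error \<open>\<nu>\<close>, and for small \<open>\<tau>1\<close>
  the condition \<open>B\<^sup>2 < 1 - \<nu>\<close> on the momentum bound \<open>B\<close> makes the Lyapunov function
  \<open>D k = f (x k) - f xbar + A / (2 * \<tau>1) * (norm (p k))\<^sup>2\<close> decrease by a multiple of
  \<open>(w k)\<^sup>2 / \<tau>1\<close>. A modified desingularizing function \<open>\<Phi>\<close> turns this into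
  \<open>c * w k \<le> \<Phi> (D k) - \<Phi> (D (k + 1))\<close> with \<open>c\<close> independent of \<open>\<tau>1\<close>; summing up, the iterates have
  finite length bounded by \<open>\<Phi> (D 1) / c\<close>, which traps them near \<open>xbar\<close> and forces convergence. For
  power functions \<open>\<psi>\<close> one gets \<open>D (k + 1) \<le> D k - c' * D k powr (2 * q)\<close>, hence rates for
  \<open>D k\<close>, and \<open>norm (x k - xt) \<le> \<Phi> (D k) / c\<close> transfers them to the iterates.\<close>

subsection \<open>Descent along one momentum step\<close>

text \<open>The mean value theorem on the segment gives the gradient at an intermediate point;
  replacing it by \<open>g x\<close> costs one Lipschitz term. This yields the factor
  \<open>L\<close> in the quadratic term.\<close>

lemma gradient_descent_inequality:
  fixes f :: "'a::real_inner \<Rightarrow> real"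
  assumes "convex S" "\<And>z. z \<in> S \<Longrightarrow> GDERIV f z :> g z" "0 \<le> L"
    and lip: "\<And>u v. u \<in> S \<Longrightarrow> v \<in> S \<Longrightarrow> norm (g u - g v) \<le> L * norm (u - v)"
    and "x \<in> S" "y \<in> S"
  shows "f y \<le> f x + inner (g x) (y - x) + L * (norm (y - x))\<^sup>2"
proof -
  define c where "c t = x + t *\<^sub>R (y - x)" for t
  have cS: "c t \<in> S" if "0 \<le> t" "t \<le> 1" for t
    using convexD_alt[OF assms(1) \<open>x \<in> S\<close> \<open>y \<in> S\<close>, of t] that
    by (simp add: c_def algebra_simps)
  have der: "DERIV (\<lambda>t. f (c t)) t :> inner (y - x) (g (c t))" if "0 \<le> t" "t \<le> 1" for t
  proof -
    have "(c has_derivative (\<lambda>h. h *\<^sub>R (y - x))) (at t)"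
      unfolding c_def by (auto intro!: derivative_eq_intros)
    moreover have "(f has_derivative (\<lambda>h. inner h (g (c t)))) (at (c t))"
      using assms(2) cS[OF that] by (simp add: gderiv_def)
    ultimately have "((\<lambda>t. f (c t)) has_derivative (\<lambda>h. inner (h *\<^sub>R (y - x)) (g (c t)))) (at t)"
      by (rule has_derivative_compose)
    then show ?thesis
      by (simp add: has_field_derivative_def mult_commute_abs)
  qed
  obtain t where t: "0 < t" "t < 1" and eq: "f (c 1) - f (c 0) = inner (y - x) (g (c t))"
    using MVT2[of 0 1 "\<lambda>t. f (c t)" "\<lambda>t. inner (y - x) (g (c t))"] der by auto
  have "norm (g (c t) - g x) \<le> L * norm (c t - x)"
    using lip cS[of t] t \<open>x \<in> S\<close> by simp
  also have "\<dots> = L * (t * norm (y - x))"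
    using t by (simp add: c_def)
  also have "\<dots> \<le> L * (1 * norm (y - x))"
    using t \<open>0 \<le> L\<close> by (intro mult_left_mono mult_right_mono) auto
  finally have "norm (y - x) * norm (g (c t) - g x) \<le> norm (y - x) * (L * norm (y - x))"
    by (intro mult_left_mono) auto
  then have "inner (y - x) (g (c t) - g x) \<le> norm (y - x) * (L * norm (y - x))"
    by (rule order_trans[OF norm_cauchy_schwarz])
  then show ?thesis
    using eq by (simp add: c_def inner_diff_right inner_commute power2_eq_square algebra_simps)
qed

lemma GDERIV_local_min_zero:
  assumes "GDERIV f x :> G" "0 < e" "\<And>y. y \<in> ball x e \<Longrightarrow> f x \<le> f y"
  shows "G = 0"
proof -
  have "(\<lambda>h. inner h G) = (\<lambda>h. 0)"
    using assms differential_zero_maxmin[of x "ball x e" f "\<lambda>h. inner h G"]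
    by (simp add: gderiv_def)
  then show ?thesis
    \<comment> \<open>Evaluating the vanishing derivative at \<open>G\<close> itself gives
      \<open>inner G G = 0\<close>.\<close>
    using fun_cong[of _ _ G] by fastforce
qed

text \<open>Tangent inequality for the convex function \<open>- \<phi>\<close>. Only the point of
  tangency \<open>a\<close> has to be interior, so a jump of \<open>\<phi>\<close> at 0 does no
  harm.\<close>

lemma concave_deriv_tangent:
  fixes \<phi> :: "real \<Rightarrow> real"
  assumes "concave_on {0..<e} \<phi>" "0 < a" "a < e" "0 \<le> b" "b < e" "DERIV \<phi> a :> d"
  shows "\<phi> b - \<phi> a \<le> d * (b - a)"
proof -
  have "((\<lambda>x. - \<phi> x) has_real_derivative - d) (at a within {0..<e})"
    using DERIV_minus[OF assms(6)] by (rule has_field_derivative_at_within)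
  moreover have "a \<in> interior {0..<e}"
    using assms by (simp add: interior_atLeastLessThan)
  ultimately have "(- \<phi> b) - (- \<phi> a) \<ge> - d * (b - a)"
    using assms by (intro convex_on_imp_above_tangent[where A = "{0..<e}"])
      (auto simp: concave_on_def)
  then show ?thesis by simp
qed

text \<open>Below, \<open>G\<close> is the gradient at \<open>x\<^sub>e\<^sub>x\<close> and \<open>d\<close> the gradient at \<open>x\<^sub>e\<^sub>x + \<tau> *\<^sub>R G\<close>.\<close>

lemma perturbed_gradient_bounds:
  fixes d G :: "'a::real_normed_vector"
  assumes "0 < L" "0 < \<nu>" "\<nu> < 1" "0 \<le> \<tau>" "\<tau> \<le> \<nu> / (L * (\<nu> + 1))"
    and "norm (d - G) \<le> L * (\<tau> * norm G)"
  shows "norm (G - d) \<le> \<nu> * norm d" "norm G \<le> 2 * norm d"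
proof -
  \<comment> \<open>The range of \<open>\<tau>\<close> makes the error at most the fraction
    \<open>\<nu> / (\<nu> + 1)\<close> of \<open>norm G\<close>. Since
    \<open>norm G \<le> norm d + norm (d - G)\<close>, solving for the error leaves the fraction
    \<open>\<nu>\<close> of \<open>norm d\<close>.\<close>
  have "L * \<tau> \<le> \<nu> / (\<nu> + 1)"
    using mult_left_mono[OF assms(5), of L] assms(1) by simp
  then have "L * \<tau> * norm G \<le> \<nu> / (\<nu> + 1) * norm G"
    by (intro mult_right_mono) auto
  with assms(6) have "norm (d - G) \<le> \<nu> * norm G / (\<nu> + 1)"
    by (simp add: mult.assoc)
  then have 1: "norm (d - G) * (\<nu> + 1) \<le> \<nu> * norm G"
    using assms(2) by (simp add: pos_le_divide_eq)
  have 2: "norm G \<le> norm d + norm (d - G)"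
    using norm_triangle_ineq4[of d "d - G"] by simp
  have "\<nu> * norm G \<le> \<nu> * (norm d + norm (d - G))"
    using 2 assms(2) by (intro mult_left_mono) auto
  with 1 have 3: "norm (d - G) \<le> \<nu> * norm d"
    by (simp add: algebra_simps)
  then show "norm (G - d) \<le> \<nu> * norm d"
    by (simp add: norm_minus_commute)
  have "\<nu> * norm d \<le> 1 * norm d"
    using assms by (intro mult_right_mono) auto
  then show "norm G \<le> 2 * norm d"
    using 2 3 by simp
qed

text \<open>The step rule expresses \<open>\<tau> *\<^sub>R d\<close> as \<open>q - p'\<close> with
  \<open>q = b *\<^sub>R p\<close>. Splitting \<open>G\<close> into \<open>d\<close> and the
  relative error, and bounding the error by Cauchy-Schwarz and Young, leaves the cross term
  \<open>(1 - \<nu>) * inner q p'\<close>, to which Young's inequality applies once more.\<close>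

lemma momentum_step_inner:
  fixes p p' d G :: "'a::real_inner"
  assumes "0 \<le> \<nu>" "\<nu> \<le> 1" "0 \<le> b" "norm (G - d) \<le> \<nu> * norm d" "0 < \<tau>"
    and p': "p' = b *\<^sub>R p - \<tau> *\<^sub>R d"
  shows "\<tau> * inner G p' \<le> b\<^sup>2 / 2 * (norm p)\<^sup>2 - (1 - \<nu>) / 2 * (norm p')\<^sup>2"
proof -
  define q where "q = b *\<^sub>R p"
  have td: "\<tau> *\<^sub>R d = q - p'"
    using p' by (simp add: q_def)
  have nq: "norm (q - p') = \<tau> * norm d"
    using td[symmetric] assms(5) by simp
  have "\<tau> * inner (G - d) p' \<le> \<tau> * (norm (G - d) * norm p')"
    using assms(5) norm_cauchy_schwarz[of "G - d" p'] by (intro mult_left_mono) auto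
  also have "\<dots> \<le> \<tau> * ((\<nu> * norm d) * norm p')"
    using assms by (intro mult_left_mono mult_right_mono) auto
  also have "\<dots> = \<nu> * (norm (q - p') * norm p')"
    by (simp add: nq)
  also have "\<dots> \<le> \<nu> * (((norm (q - p'))\<^sup>2 + (norm p')\<^sup>2) / 2)"
    using assms(1) sum_squares_bound[of "norm (q - p')" "norm p'"]
    by (intro mult_left_mono) (auto simp: algebra_simps)
  finally have 1: "\<tau> * inner (G - d) p' \<le> \<nu> * (((norm (q - p'))\<^sup>2 + (norm p')\<^sup>2) / 2)" .
  have 2: "\<tau> * inner d p' = inner q p' - (norm p')\<^sup>2"
    using arg_cong[OF td, of "\<lambda>v. inner v p'"]
    by (simp add: inner_diff_left power2_norm_eq_inner)
  have 3: "(norm (q - p'))\<^sup>2 = (norm q)\<^sup>2 - 2 * inner q p' + (norm p')\<^sup>2"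
    by (simp add: power2_norm_eq_inner inner_diff_left inner_diff_right inner_commute)
  have "0 \<le> (norm (q - p'))\<^sup>2" by simp
  then have "inner q p' \<le> ((norm q)\<^sup>2 + (norm p')\<^sup>2) / 2"
    using 3 by simp
  then have 4: "(1 - \<nu>) * inner q p' \<le> (1 - \<nu>) * (((norm q)\<^sup>2 + (norm p')\<^sup>2) / 2)"
    using assms by (intro mult_left_mono) auto
  have "\<tau> * inner G p' = \<tau> * inner (G - d) p' + \<tau> * inner d p'"
    by (simp add: inner_diff_left algebra_simps)
  also have "\<dots> \<le> (norm q)\<^sup>2 / 2 - (1 - \<nu>) / 2 * (norm p')\<^sup>2"
    using 1 2 4 unfolding 3 by (simp add: field_simps)
  also have "(norm q)\<^sup>2 = b\<^sup>2 * (norm p)\<^sup>2"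
    using assms(3) by (simp add: q_def power_mult_distrib)
  finally show ?thesis by simp
qed

text \<open>The weight \<open>A\<close> is the midpoint of \<open>B\<^sup>2\<close> and
  \<open>1 - \<nu>\<close>, which lies \<open>\<omega> / 2\<close> away from both. After the factor
  1/2 this leaves a surplus \<open>\<omega> / 4\<close> in front of each squared norm; the bound on
  \<open>\<tau>\<close> lets the Lipschitz errors consume at most half of it.\<close>

lemma momentum_step_descent:
  fixes p p' d G h :: "'a::real_inner"
  assumes "0 < \<nu>" "\<nu> < 1" "0 \<le> b" "b \<le> B" "0 \<le> c" "c \<le> \<Gamma>" "0 < L" "0 < \<tau>"
    and \<omega>: "\<omega> = 1 - \<nu> - B\<^sup>2" and \<tau>\<omega>: "\<tau> * L * (\<Gamma> + 2) \<le> \<omega> / 4"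
    and A: "A = (1 - \<nu> + B\<^sup>2) / 2"
    and "norm (G - d) \<le> \<nu> * norm d" "p' = b *\<^sub>R p - \<tau> *\<^sub>R d"
    and h: "norm (h - G) \<le> L * (c * norm p)"
    and F: "F' \<le> F + inner h p' + L * (norm p')\<^sup>2"
    and w: "w = norm p + norm p'"
  shows "F' + A / (2 * \<tau>) * (norm p')\<^sup>2 + \<omega> / (16 * \<tau>) * w\<^sup>2
      \<le> F + A / (2 * \<tau>) * (norm p)\<^sup>2"
proof -
  let ?a = "norm p" and ?b = "norm p'"
  have ab: "2 * (?a * ?b) \<le> ?a\<^sup>2 + ?b\<^sup>2"
    using sum_squares_bound[of ?a ?b] by (simp add: mult.assoc)
  have "inner (h - G) p' \<le> norm (h - G) * ?b"
    by (rule norm_cauchy_schwarz)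
  also have "\<dots> \<le> L * (\<Gamma> * ?a) * ?b"
    using h assms(6,7)
    by (intro mult_right_mono) (auto intro!: order_trans[OF h] mult_left_mono mult_right_mono)
  finally have hG: "inner (h - G) p' \<le> L * \<Gamma> * (?a * ?b)"
    by (simp add: mult.assoc)
  have "\<tau> * inner (h - G) p' \<le> \<tau> * (L * \<Gamma> * (?a * ?b))"
    using hG assms(8) by (intro mult_left_mono) auto
  also have "\<dots> \<le> \<tau> * (L * \<Gamma> * ((?a\<^sup>2 + ?b\<^sup>2) / 2))"
    using ab assms by (intro mult_left_mono) auto
  finally have 1: "\<tau> * inner (h - G) p' \<le> \<tau> * L * \<Gamma> / 2 * (?a\<^sup>2 + ?b\<^sup>2)"
    by simp
  have 2: "\<tau> * inner G p' \<le> b\<^sup>2 / 2 * ?a\<^sup>2 - (1 - \<nu>) / 2 * ?b\<^sup>2"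
    using assms by (intro momentum_step_inner[where d = d]) auto
  have "b\<^sup>2 / 2 * ?a\<^sup>2 \<le> B\<^sup>2 / 2 * ?a\<^sup>2"
    using assms by (intro mult_right_mono divide_right_mono power_mono) auto
  moreover have "\<tau> * inner h p' = \<tau> * inner (h - G) p' + \<tau> * inner G p'"
    by (simp add: inner_diff_left right_diff_distrib)
  ultimately have 3: "\<tau> * inner h p' \<le> B\<^sup>2 / 2 * ?a\<^sup>2 - (1 - \<nu>) / 2 * ?b\<^sup>2 + \<tau> * L * \<Gamma> / 2 * (?a\<^sup>2 + ?b\<^sup>2)"
    using 1 2 by linarith
  have "\<tau> * F' \<le> \<tau> * (F + inner h p' + L * ?b\<^sup>2)"
    using F assms(8) by (intro mult_left_mono) auto
  also have "\<dots> = \<tau> * F + \<tau> * inner h p' + \<tau> * L * ?b\<^sup>2"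
    by (simp add: algebra_simps)
  also have "\<dots> \<le> \<tau> * F + (B\<^sup>2 / 2 * ?a\<^sup>2 - (1 - \<nu>) / 2 * ?b\<^sup>2 + \<tau> * L * \<Gamma> / 2 * (?a\<^sup>2 + ?b\<^sup>2))
      + \<tau> * L * (?a\<^sup>2 + ?b\<^sup>2)"
    using 3 assms by (intro add_mono mult_left_mono) auto
  also have "\<dots> = \<tau> * F + (B\<^sup>2 / 2 * ?a\<^sup>2 - (1 - \<nu>) / 2 * ?b\<^sup>2) + (\<tau> * L * (\<Gamma> + 2)) * ((?a\<^sup>2 + ?b\<^sup>2) / 2)"
    by (simp add: field_simps)
  also have "\<dots> \<le> \<tau> * F + (B\<^sup>2 / 2 * ?a\<^sup>2 - (1 - \<nu>) / 2 * ?b\<^sup>2) + (\<omega> / 4) * ((?a\<^sup>2 + ?b\<^sup>2) / 2)"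
    using \<tau>\<omega> by (intro add_left_mono mult_right_mono) auto
  also have "\<dots> = \<tau> * F + A / 2 * ?a\<^sup>2 - A / 2 * ?b\<^sup>2 - \<omega> / 8 * (?a\<^sup>2 + ?b\<^sup>2)"
    unfolding \<omega> A by (simp add: field_simps)
  finally have 4: "\<tau> * F' + A / 2 * ?b\<^sup>2 + \<omega> / 8 * (?a\<^sup>2 + ?b\<^sup>2) \<le> \<tau> * F + A / 2 * ?a\<^sup>2"
    by simp
  have "0 \<le> \<tau> * L * (\<Gamma> + 2)"
    using assms by simp
  then have "0 \<le> \<omega>" using \<tau>\<omega> by linarith
  \<comment> \<open>Passing from the sum of squares to the square of the sum turns the remaining
    \<open>\<omega> / 8\<close> into \<open>\<omega> / 16\<close>.\<close>
  moreover have "w\<^sup>2 \<le> 2 * (?a\<^sup>2 + ?b\<^sup>2)"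
    using ab by (simp add: w power2_sum)
  ultimately have "\<omega> / 16 * w\<^sup>2 \<le> \<omega> / 16 * (2 * (?a\<^sup>2 + ?b\<^sup>2))"
    by (intro mult_left_mono) auto
  with 4 have "\<tau> * F' + A / 2 * ?b\<^sup>2 + \<omega> / 16 * w\<^sup>2 \<le> \<tau> * F + A / 2 * ?a\<^sup>2"
    by (simp add: algebra_simps)
  then have "(\<tau> * F' + A / 2 * ?b\<^sup>2 + \<omega> / 16 * w\<^sup>2) / \<tau> \<le> (\<tau> * F + A / 2 * ?a\<^sup>2) / \<tau>"
    using assms(8) by (intro divide_right_mono) auto
  then show ?thesis
    using assms(8) by (simp add: add_divide_distrib)
qed

subsection \<open>Decay of recursively decreasing sequences\<close>

lemma linear_decay_recursion:
  fixes D :: "nat \<Rightarrow> real"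
  assumes "\<And>k. 1 \<le> k \<Longrightarrow> 0 < D k" "\<And>k. 1 \<le> k \<Longrightarrow> D (Suc k) \<le> D k - c * D k" "0 < c"
  obtains \<mu> K where "0 < \<mu>" "\<mu> < 1" "0 < K" "\<And>k. 1 \<le> k \<Longrightarrow> D k \<le> K * \<mu> ^ k"
proof -
  define \<mu> where "\<mu> = 1 - c"
  have st: "D (Suc k) \<le> \<mu> * D k" if "1 \<le> k" for k
    using assms(2)[OF that] by (simp add: \<mu>_def algebra_simps)
  \<comment> \<open>Positivity of the sequence forces \<open>c < 1\<close>: the second value is
    positive and at most \<open>\<mu>\<close> times the first.\<close>
  have pos: "0 < \<mu>"
  proof -
    have "0 < \<mu> * D 1"
      using st[of 1] assms(1)[of "Suc 1"] by linarith
    then show ?thesis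
      using assms(1)[of 1] by (simp add: zero_less_mult_iff)
  qed
  have "D k \<le> (D 1 / \<mu>) * \<mu> ^ k" if "1 \<le> k" for k
    using that
  proof (induction k rule: dec_induct)
    case base
    then show ?case using pos by simp
  next
    case (step n)
    have "D (Suc n) \<le> \<mu> * D n" using st step by simp
    also have "\<dots> \<le> \<mu> * ((D 1 / \<mu>) * \<mu> ^ n)"
      using step pos by (intro mult_left_mono) auto
    finally show ?case by (simp add: algebra_simps)
  qed
  then show thesis
    using pos assms(1)[of 1] assms(3) by (intro that[of \<mu> "D 1 / \<mu>"]) (auto simp: \<mu>_def)
qed

text \<open>The reciprocal power \<open>D powr - s\<close> grows by at least a fixed amount in every step.\<close>

lemma sublinear_decay_recursion:
  fixes D :: "nat \<Rightarrow> real"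
  assumes pos: "\<And>k. 1 \<le> k \<Longrightarrow> 0 < D k"
    and dec: "\<And>k. 1 \<le> k \<Longrightarrow> D (Suc k) \<le> D k - c * D k powr (1 + s)"
    and "0 < c" "0 < s"
  obtains K where "0 < K" "\<And>k. 1 \<le> k \<Longrightarrow> D k \<le> K * real k powr (- 1 / s)"
proof -
  have inc: "D k powr (- s) + s * c \<le> D (Suc k) powr (- s)" if k: "1 \<le> k" for k
  proof -
    have lt: "D (Suc k) < D k"
    proof -
      have "0 < c * D k powr (1 + s)" using pos[OF k] \<open>0 < c\<close> by simp
      then show ?thesis using dec[OF k] by linarith
    qed
    have "\<exists>z>D (Suc k). z < D k \<and> D k powr (-s) - D (Suc k) powr (-s)
        = (D k - D (Suc k)) * (- s * z powr (- s - 1))"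
      using lt pos[of "Suc k"]
      by (intro MVT2) (auto intro!: derivative_eq_intros simp: powr_diff)
    then obtain z where z: "D (Suc k) < z" "z < D k"
      and eq: "D k powr (-s) - D (Suc k) powr (-s) = (D k - D (Suc k)) * (- s * z powr (- s - 1))"
      by blast
    have zp: "0 < z" using z pos[of "Suc k"] by simp
    \<comment> \<open>The exponent is negative and \<open>z < D k\<close>, so the derivative factor
      may be evaluated at \<open>D k\<close>, where the powers \<open>1 + s\<close> and
      \<open>- s - 1\<close> cancel.\<close>
    have "D k powr (- s - 1) \<le> z powr (- s - 1)"
      using z zp \<open>0 < s\<close> by (intro powr_mono2') auto
    moreover have "c * D k powr (1 + s) \<le> D k - D (Suc k)"
      using dec[OF k] by simp
    ultimately have "c * D k powr (1 + s) * D k powr (- s - 1) \<le> (D k - D (Suc k)) * z powr (- s - 1)"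
      using lt \<open>0 < c\<close> by (intro mult_mono) auto
    moreover have "D k powr (1 + s) * D k powr (- s - 1) = 1"
      using pos[OF k] by (simp flip: powr_add)
    ultimately have "c \<le> (D k - D (Suc k)) * z powr (- s - 1)"
      by (simp add: mult.assoc)
    then have "s * c \<le> s * ((D k - D (Suc k)) * z powr (- s - 1))"
      using \<open>0 < s\<close> by (intro mult_left_mono) auto
    then show ?thesis using eq by (simp add: algebra_simps)
  qed
  \<comment> \<open>Bounding both the first value and the increment from below, \<open>m\<close>
    gives linear growth \<open>m * real k\<close> without an offset.\<close>
  define m where "m = min (D 1 powr (- s)) (s * c)"
  have m: "0 < m" using pos[of 1] \<open>0 < c\<close> \<open>0 < s\<close> by (simp add: m_def)
  have low: "m * real k \<le> D k powr (- s)" if "1 \<le> k" for k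
    using that
  proof (induction k rule: dec_induct)
    case base
    then show ?case by (simp add: m_def)
  next
    case (step n)
    have "m \<le> s * c" by (simp add: m_def)
    then show ?case using step inc[of n] by (simp add: algebra_simps)
  qed
  have "D k \<le> m powr (- 1 / s) * real k powr (- 1 / s)" if k: "1 \<le> k" for k
  proof -
    have "(D k powr (- s)) powr (- 1 / s) \<le> (m * real k) powr (- 1 / s)"
      using low[OF k] m k \<open>0 < s\<close> by (intro powr_mono2') auto
    then show ?thesis
      using pos[OF k] \<open>0 < s\<close> m by (simp add: powr_powr powr_mult)
  qed
  then show thesis
    using m by (intro that[of "m powr (- 1 / s)"]) auto
qed

subsection \<open>Desingularizing the Lyapunov function\<close>

text \<open>The Lyapunov value \<open>t + s\<close> exceeds \<open>t = f x - f xbar\<close>, so \<open>\<phi>' t\<close> does not bound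
  \<open>\<phi>' (t + s)\<close> from below. For \<open>s \<le> t\<close> halving the argument of \<open>\<phi>\<close> repairs this, for \<open>s > t\<close>
  the square root in the function constructed here takes over. Subtracting \<open>\<phi>0\<close> removes a
  possible jump of \<open>\<phi>\<close> at \<open>0\<close>.\<close>

lemma plk_merit_function:
  assumes plk: "plk_condition X f g xbar \<eta> \<phi>"
  obtains \<eta>0 \<rho> :: real and \<Phi> \<Phi>' :: "real \<Rightarrow> real"
  where "0 < \<eta>0" "0 < \<rho>"
    and "\<And>u. 0 < u \<Longrightarrow> u < \<eta>0 \<Longrightarrow> 0 \<le> \<Phi> u"
    and "\<And>u. 0 < u \<Longrightarrow> u < \<eta>0 \<Longrightarrow> 0 < \<Phi>' u"
    and "\<And>u v. 0 < v \<Longrightarrow> v \<le> u \<Longrightarrow> u < \<eta>0 \<Longrightarrow> \<Phi>' u * (u - v) \<le> \<Phi> u - \<Phi> v"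
    and "(\<Phi> \<longlongrightarrow> 0) (at_right 0)"
    and "\<And>x s. x \<in> ball xbar \<rho> \<Longrightarrow> f xbar \<le> f x \<Longrightarrow> 0 \<le> s \<Longrightarrow> 0 < f x - f xbar + s \<Longrightarrow>
      f x - f xbar + s < \<eta>0 \<Longrightarrow> 1 \<le> \<Phi>' (f x - f xbar + s) * (norm (g x) + 3 * sqrt s)"
    and "\<And>M q. 0 < M \<Longrightarrow> 1 / 2 \<le> q \<Longrightarrow> q < 1 \<Longrightarrow>
      \<forall>t. 0 \<le> t \<and> ereal t < \<eta> \<longrightarrow> \<phi> t = M * t powr (1 - q) \<Longrightarrow>
      \<exists>C>0. \<forall>u\<in>{0<..<\<eta>0}. \<Phi> u \<le> C * u powr (1 - q) \<and> \<Phi>' u \<le> C * u powr (- q)"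
proof -
  obtain e where e: "0 < ereal e" "ereal e < \<eta>"
    using plk ereal_dense2[of 0 \<eta>] by (auto simp: plk_condition_def)
  \<comment> \<open>A real end point copes with \<open>\<eta> = \<infinity>\<close>; capping it at 1
    makes powers of arguments below \<open>h\<close> decrease in the exponent.\<close>
  define h where "h = min 1 e"
  have h: "0 < h" "h \<le> 1" "ereal h < \<eta>"
    using e by (auto simp: h_def min_def intro: order.strict_trans1[of _ "ereal e"])
  have dom: "ereal t < \<eta>" if "t \<le> h" for t
    using h(3) that by (metis ereal_less_eq(3) order.strict_trans1)
  have conc: "concave_on {0..<h} \<phi>"
    using plk dom unfolding plk_condition_def concave_on_def
    by (auto elim!: convex_on_subset)
  have der: "DERIV \<phi> t :> deriv \<phi> t" if "0 < t" "t < h" for t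
  proof -
    have "\<phi> differentiable at t"
      using plk that dom[of t] by (auto simp: plk_condition_def C1_differentiable_on_eq)
    then show ?thesis by (simp add: DERIV_deriv_iff_real_differentiable)
  qed
  have dpos: "0 < deriv \<phi> t" if "0 < t" "t < h" for t
    using plk that dom[of t] by (auto simp: plk_condition_def)
  have nonneg: "0 \<le> \<phi> t" if "0 \<le> t" "t < h" for t
    using plk that dom[of t] by (auto simp: plk_condition_def)
  have tang: "\<phi> b - \<phi> a \<le> deriv \<phi> a * (b - a)" if "0 < a" "a < h" "0 < b" "b < h" for a b
    using concave_deriv_tangent[OF conc _ _ _ _ der] that by simp
  have mono: "\<phi> a \<le> \<phi> b" if "0 < a" "a \<le> b" "b < h" for a b
  proof -
    have "deriv \<phi> b * (a - b) \<le> 0"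
      using dpos[of b] that by (intro mult_nonneg_nonpos) auto
    then show ?thesis using tang[of b a] that by simp
  qed
  have danti: "deriv \<phi> b \<le> deriv \<phi> a" if "0 < a" "a \<le> b" "b < h" for a b
  proof (cases "a = b")
    case False
    then have "deriv \<phi> b * (b - a) \<le> deriv \<phi> a * (b - a)"
      using tang[of a b] tang[of b a] that by (simp add: algebra_simps)
    then show ?thesis using False that by simp
  qed auto
  \<comment> \<open>As \<open>\<phi>\<close> is increasing on \<open>{0<..<h}\<close>, this infimum
    is its right limit at 0.\<close>
  define \<phi>0 where "\<phi>0 = (INF t\<in>{0<..<h}. \<phi> t)"
  have bdd: "bdd_below (\<phi> ` {0<..<h})"
    using nonneg by (intro bdd_belowI2[where m = 0]) auto
  have \<phi>0_le: "\<phi>0 \<le> \<phi> t" if "0 < t" "t < h" for t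
    unfolding \<phi>0_def using that bdd by (intro cINF_lower) auto
  have \<phi>0_nonneg: "0 \<le> \<phi>0"
    unfolding \<phi>0_def using nonneg h by (intro cINF_greatest) auto
  have near: "\<exists>t0. 0 < t0 \<and> t0 < h \<and> \<phi> t0 < \<phi>0 + d" if "0 < d" for d
  proof -
    have "(INF t\<in>{0<..<h}. \<phi> t) < \<phi>0 + d"
      using that by (simp add: \<phi>0_def)
    then show ?thesis
      using bdd h by (subst (asm) cINF_less_iff) auto
  qed
  have lim\<phi>: "(\<phi> \<longlongrightarrow> \<phi>0) (at_right 0)"
  proof (rule order_tendstoI)
    fix a assume "a < \<phi>0"
    then show "\<forall>\<^sub>F t in at_right 0. a < \<phi> t"
      unfolding eventually_at_right_field using h \<phi>0_le by (intro exI[of _ h]) fastforce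
  next
    fix a assume "\<phi>0 < a"
    then obtain t0 where "0 < t0" "t0 < h" "\<phi> t0 < a"
      using near[of "a - \<phi>0"] by auto
    moreover have "\<phi> y \<le> \<phi> t0" if "0 < y" "y < t0" for y
      using mono[of y t0] that \<open>t0 < h\<close> by simp
    ultimately show "\<forall>\<^sub>F t in at_right 0. \<phi> t < a"
      unfolding eventually_at_right_field by (intro exI[of _ t0]) fastforce
  qed
  \<comment> \<open>The factor 2 compensates the halved argument, so that \<open>\<Phi>'\<close>
    below is the derivative of \<open>\<Phi>\<close>.\<close>
  define \<Phi> where "\<Phi> u = 2 * (\<phi> (u / 2) - \<phi>0) + sqrt u" for u
  define \<Phi>' where "\<Phi>' u = deriv \<phi> (u / 2) + 1 / (2 * sqrt u)" for u
  obtain U where U: "xbar \<in> interior U"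
    and plkU: "\<And>x. x \<in> U \<Longrightarrow> f xbar < f x \<Longrightarrow> ereal (f x) < ereal (f xbar) + \<eta> \<Longrightarrow>
      1 \<le> deriv \<phi> (f x - f xbar) * norm (g x)"
    using plk by (auto simp: plk_condition_def)
  obtain \<rho> where \<rho>: "0 < \<rho>" "ball xbar \<rho> \<subseteq> U"
    using U by (auto simp: mem_interior)
  have grad: "1 \<le> deriv \<phi> (f x - f xbar) * norm (g x)"
    if "x \<in> ball xbar \<rho>" "f xbar < f x" "f x - f xbar < h" for x
  proof (rule plkU)
    have "ereal (f xbar) + ereal (f x - f xbar) < ereal (f xbar) + \<eta>"
      using dom[of "f x - f xbar"] that by (intro ereal_less_add) auto
    then show "ereal (f x) < ereal (f xbar) + \<eta>" by simp
  qed (use that \<rho> in auto)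
  have \<Phi>'_pos: "0 < \<Phi>' u" if "0 < u" "u < h" for u
    using that h dpos[of "u / 2"] by (simp add: \<Phi>'_def add_pos_pos)
  show thesis
  proof (rule that[of h \<rho> \<Phi> \<Phi>'])
    show "0 < h" "0 < \<rho>" using h \<rho> by auto
    show "0 \<le> \<Phi> u" if "0 < u" "u < h" for u
      using \<phi>0_le[of "u / 2"] that h by (simp add: \<Phi>_def)
    show "0 < \<Phi>' u" if "0 < u" "u < h" for u
      by (rule \<Phi>'_pos[OF that])
    show "\<Phi>' u * (u - v) \<le> \<Phi> u - \<Phi> v" if "0 < v" "v \<le> u" "u < h" for u v
    proof -
      have 1: "deriv \<phi> (u / 2) * (u - v) \<le> 2 * (\<phi> (u / 2) - \<phi> (v / 2))"
        using tang[of "u / 2" "v / 2"] that h by (simp add: algebra_simps)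
      have "u - v = (sqrt u - sqrt v) * (sqrt u + sqrt v)"
        using that by (simp add: algebra_simps)
      also have "\<dots> \<le> (sqrt u - sqrt v) * (2 * sqrt u)"
        using that by (intro mult_left_mono) auto
      finally have 2: "1 / (2 * sqrt u) * (u - v) \<le> sqrt u - sqrt v"
        using that by (simp add: pos_divide_le_eq)
      show ?thesis
        using 1 2 unfolding \<Phi>_def \<Phi>'_def by (simp add: distrib_right)
    qed
    have "filterlim (\<lambda>u::real. u / 2) (at_right 0) (at_right 0)"
      unfolding filterlim_at
      by (auto intro!: tendsto_eq_intros simp: eventually_at_right_field intro: exI[of _ 1])
    then have "((\<lambda>u. \<phi> (u / 2)) \<longlongrightarrow> \<phi>0) (at_right 0)"
      by (rule filterlim_compose[OF lim\<phi>])
    then show "(\<Phi> \<longlongrightarrow> 0) (at_right 0)"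
      unfolding \<Phi>_def by (auto intro!: tendsto_eq_intros)
    show "1 \<le> \<Phi>' (f x - f xbar + s) * (norm (g x) + 3 * sqrt s)"
      if x: "x \<in> ball xbar \<rho>" "f xbar \<le> f x" "0 \<le> s" "0 < f x - f xbar + s" "f x - f xbar + s < h" for x s
    proof -
      define t where "t = f x - f xbar"
      define D where "D = t + s"
      have D: "0 < D" "D < h" "0 \<le> t" using x by (auto simp: D_def t_def)
      have d: "0 < deriv \<phi> (D / 2)" using dpos[of "D / 2"] D h by simp
      have "1 \<le> \<Phi>' D * (norm (g x) + 3 * sqrt s)"
      proof (cases "s \<le> t")
        case True
        then have "0 < t" using D by (auto simp: D_def)
        have "1 \<le> deriv \<phi> t * norm (g x)"
          using grad[of x] x \<open>0 < t\<close> by (simp add: t_def)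
        also have "\<dots> \<le> \<Phi>' D * (norm (g x) + 3 * sqrt s)"
        proof (intro mult_mono)
          have "deriv \<phi> t \<le> deriv \<phi> (D / 2)"
            using danti[of "D / 2" t] D True x by (simp add: D_def)
          then show "deriv \<phi> t \<le> \<Phi>' D"
            using D by (simp add: \<Phi>'_def add_increasing2)
        qed (use x \<Phi>'_pos[OF D(1,2)] in auto)
        finally show ?thesis .
      next
        case False
        then have s: "0 < s" using D by simp
        \<comment> \<open>Here \<open>D \<le> 2 * s\<close>, and 2 is at most the square of 3/2.
          Hence \<open>2 * sqrt D \<le> 3 * sqrt s\<close>, the origin of the constant 3.\<close>
        have "sqrt D \<le> sqrt (2\<^sup>2 * s / 2)"
          using False by (simp add: D_def)
        also have "\<dots> \<le> sqrt ((3/2)\<^sup>2 * s)"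
          using s by (simp add: power2_eq_square)
        also have "\<dots> = 3 / 2 * sqrt s"
          by (simp only: real_sqrt_mult real_sqrt_abs)
        finally have "1 \<le> 1 / (2 * sqrt D) * (3 * sqrt s)"
          using D by (simp add: field_simps)
        also have "\<dots> \<le> \<Phi>' D * (norm (g x) + 3 * sqrt s)"
          using d D s by (intro mult_mono) (auto simp: \<Phi>'_def)
        finally show ?thesis .
      qed
      then show ?thesis by (simp add: D_def t_def)
    qed
    show "\<exists>C>0. \<forall>u\<in>{0<..<h}. \<Phi> u \<le> C * u powr (1 - q) \<and> \<Phi>' u \<le> C * u powr (- q)"
      if M: "0 < M" and q: "1 / 2 \<le> q" "q < 1"
        and pow: "\<forall>t. 0 \<le> t \<and> ereal t < \<eta> \<longrightarrow> \<phi> t = M * t powr (1 - q)" for M q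
    \<comment> \<open>In both bounds \<open>2 * M\<close> comes from \<open>\<phi>\<close> and 1
      from the square root, whose powers are absorbed because \<open>u \<le> 1\<close> and
      \<open>1 / 2 \<le> q\<close>.\<close>
    proof (intro exI[of _ "2 * M + 1"] conjI ballI)
      show "0 < 2 * M + 1" using M by simp
    next
      fix u assume "u \<in> {0<..<h}"
      then have u: "0 < u" "u < h" "u \<le> 1" using h by auto
      have val: "\<phi> t = M * t powr (1 - q)" if "0 < t" "t < h" for t
        using pow dom[of t] that by simp
      have "\<phi> (u / 2) \<le> M * u powr (1 - q)"
        using val[of "u / 2"] u M q by (auto intro!: powr_mono2)
      moreover have "sqrt u \<le> u powr (1 - q)"
        using u q by (auto simp: powr_half_sqrt[symmetric] intro!: powr_mono')
      ultimately show "\<Phi> u \<le> (2 * M + 1) * u powr (1 - q)"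
        using \<phi>0_nonneg by (simp add: \<Phi>_def algebra_simps)
      have "DERIV \<phi> (u / 2) :> M * ((1 - q) * (u / 2) powr (- q))"
      proof (rule has_field_derivative_transform_within_open)
        show "((\<lambda>t. M * t powr (1 - q)) has_real_derivative M * ((1 - q) * (u / 2) powr (- q))) (at (u / 2))"
          using u by (auto intro!: derivative_eq_intros)
        show "open {0<..<h}" "u / 2 \<in> {0<..<h}" using u by auto
      qed (use val in auto)
      then have "deriv \<phi> (u / 2) = M * ((1 - q) * (u / 2) powr (- q))"
        by (rule DERIV_imp_deriv)
      also have "\<dots> \<le> M * (1 * (2 * u powr (- q)))"
      proof (intro mult_left_mono mult_mono)
        have "(u / 2) powr (- q) = u powr (- q) * 2 powr q"
          using u by (simp add: powr_divide powr_minus_divide)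
        also have "\<dots> \<le> u powr (- q) * 2 powr 1"
          using q by (intro mult_left_mono powr_mono) auto
        finally show "(u / 2) powr (- q) \<le> 2 * u powr (- q)" by simp
      qed (use M q in auto)
      finally have 1: "deriv \<phi> (u / 2) \<le> 2 * M * u powr (- q)" by simp
      have "1 / (2 * sqrt u) \<le> 1 / sqrt u"
        using u by (simp add: field_simps)
      also have "\<dots> = u powr (- (1 / 2))"
        using u by (simp add: powr_minus_divide powr_half_sqrt)
      also have "\<dots> \<le> u powr (- q)"
        using u q by (intro powr_mono') auto
      finally show "\<Phi>' u \<le> (2 * M + 1) * u powr (- q)"
        using 1 by (simp add: \<Phi>'_def algebra_simps)
    qed
  qed
qed

subsection \<open>Trajectories started near the minimizer\<close>

text \<open>One trajectory, with \<open>\<Phi>\<close> and \<open>\<Phi>'\<close> abstracted to the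
  properties that the length estimate uses. The constant \<open>\<omega> / 96\<close> combines the
  16 of the descent estimate with a 6 from the gradient bound. The case
  \<open>f (x 1) = f xbar\<close>, left open by \<open>start\<close>, is excluded by
  \<open>nonzero\<close>, since \<open>x 1\<close> is its own extrapolation.\<close>

locale samm_run =
  fixes f :: "'a::euclidean_space \<Rightarrow> real" and g :: "'a \<Rightarrow> 'a" and xbar :: 'a
    and \<rho> L \<nu> B \<Gamma> :: real and \<beta> \<gamma> :: "nat \<Rightarrow> real" and \<tau>1 \<tau>2 :: real and x :: "nat \<Rightarrow> 'a"
    and \<Phi> \<Phi>' :: "real \<Rightarrow> real" and \<eta>0 \<omega> :: real
  defines "\<omega> \<equiv> 1 - \<nu> - B\<^sup>2"
  assumes \<rho>_pos: "0 < \<rho>" and L_pos: "0 < L"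
    and gderiv: "\<And>z. z \<in> ball xbar \<rho> \<Longrightarrow> GDERIV f z :> g z"
    and lip: "\<And>u v. u \<in> ball xbar \<rho> \<Longrightarrow> v \<in> ball xbar \<rho> \<Longrightarrow> norm (g u - g v) \<le> L * norm (u - v)"
    and minimal: "\<And>z. z \<in> ball xbar \<rho> \<Longrightarrow> f xbar \<le> f z"
    and \<nu>: "0 < \<nu>" "\<nu> < 1" and B: "0 \<le> B" and \<omega>_pos: "0 < \<omega>" and \<Gamma>: "B \<le> \<Gamma>"
    and \<beta>: "\<And>k. 1 \<le> k \<Longrightarrow> 0 \<le> \<beta> k" "\<And>k. 1 \<le> k \<Longrightarrow> \<beta> k \<le> B"
    and \<gamma>: "\<And>k. 1 \<le> k \<Longrightarrow> 0 \<le> \<gamma> k" "\<And>k. 1 \<le> k \<Longrightarrow> \<gamma> k \<le> \<Gamma>"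
    and \<tau>1: "0 < \<tau>1" "\<tau>1 \<le> 1" "\<tau>1 * L * (\<Gamma> + 2) \<le> \<omega> / 4"
    and \<tau>2: "0 \<le> \<tau>2" "\<tau>2 \<le> \<nu> / (L * (\<nu> + 1))"
    and samm: "samm_sequence g \<beta> \<gamma> \<tau>1 \<tau>2 x"
    and nonzero: "\<And>k. 1 \<le> k \<Longrightarrow> g (extrapolate \<gamma> x k) \<noteq> 0"
    and \<Phi>_nonneg: "\<And>u. 0 < u \<Longrightarrow> u < \<eta>0 \<Longrightarrow> 0 \<le> \<Phi> u"
    and \<Phi>'_pos: "\<And>u. 0 < u \<Longrightarrow> u < \<eta>0 \<Longrightarrow> 0 < \<Phi>' u"
    and \<Phi>_tangent: "\<And>u v. 0 < v \<Longrightarrow> v \<le> u \<Longrightarrow> u < \<eta>0 \<Longrightarrow> \<Phi>' u * (u - v) \<le> \<Phi> u - \<Phi> v"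
    and \<Phi>_grad: "\<And>z s. z \<in> ball xbar \<rho> \<Longrightarrow> f xbar \<le> f z \<Longrightarrow> 0 \<le> s \<Longrightarrow> 0 < f z - f xbar + s \<Longrightarrow>
      f z - f xbar + s < \<eta>0 \<Longrightarrow> 1 \<le> \<Phi>' (f z - f xbar + s) * (norm (g z) + 3 * sqrt s)"
    and start_\<rho>: "norm (x 1 - xbar) < \<rho> / (4 * (1 + \<Gamma>))"
    and start: "f xbar < f (x 1) \<Longrightarrow> f (x 1) - f xbar < \<eta>0 \<and>
      \<omega> / 96 * norm (x 1 - xbar) + \<Phi> (f (x 1) - f xbar) < \<omega> / 96 * (\<rho> / (4 * (1 + \<Gamma>)))"
begin

section \<open>Auxiliary quantities and estimates for a single step\<close>

definition "A = (1 - \<nu> + B\<^sup>2) / 2"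
text \<open>If \<open>x k\<close> is within \<open>R\<close> of \<open>xbar\<close> and
  \<open>norm (p k) < R\<close>, then every point at which step \<open>k\<close> evaluates the
  gradient, and also \<open>x (Suc k)\<close>, stays in \<open>ball xbar \<rho>\<close>.\<close>

definition "R = \<rho> / (4 * (1 + \<Gamma>))"
definition "p k = x k - x (k - 1)"
definition "w k = norm (p k) + norm (p (Suc k))"
definition "D k = f (x k) - f xbar + A / (2 * \<tau>1) * (norm (p k))\<^sup>2"

definition "dir k = g (extrapolate \<gamma> x k + \<tau>2 *\<^sub>R g (extrapolate \<gamma> x k))"

lemma \<omega>_less_1: "\<omega> < 1"
  using \<nu> by (simp add: \<omega>_def less_le_trans[OF _ zero_le_power2])

lemma A_bounds: "0 < A" "A \<le> 1"
  using \<nu> \<omega>_pos by (auto simp: A_def \<omega>_def add_pos_nonneg)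

lemma R_pos: "0 < R" and \<Gamma>_R: "(1 + \<Gamma>) * R = \<rho> / 4" and R_le: "R \<le> \<rho> / 4"
proof -
  show "0 < R" and 1: "(1 + \<Gamma>) * R = \<rho> / 4"
    using \<rho>_pos B \<Gamma> by (auto simp: R_def field_simps)
  then have "1 * R \<le> (1 + \<Gamma>) * R"
    using B \<Gamma> by (intro mult_right_mono) auto
  then show "R \<le> \<rho> / 4" using 1 by simp
qed

lemma xbar_in: "xbar \<in> ball xbar \<rho>"
  using \<rho>_pos by simp

lemma in_ball_iff: "z \<in> ball xbar \<rho> \<longleftrightarrow> norm (z - xbar) < \<rho>"
  by (simp add: dist_norm norm_minus_commute)

lemma stationary_if_minimal:
  assumes "z \<in> ball xbar \<rho>" "f z = f xbar"
  shows "g z = 0"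
proof -
  obtain e where "0 < e" "ball z e \<subseteq> ball xbar \<rho>"
    using openE[OF open_ball assms(1)] .
  then show ?thesis
    using GDERIV_local_min_zero[OF gderiv[OF assms(1)]] minimal assms(2) by (metis subsetD)
qed

lemma norm_g_le: "z \<in> ball xbar \<rho> \<Longrightarrow> norm (g z) \<le> L * norm (z - xbar)"
  using lip[of z xbar] stationary_if_minimal[of xbar] xbar_in by simp

lemma extrapolate_eq: "extrapolate c x k = x k + c k *\<^sub>R p k"
  by (simp add: extrapolate_def p_def)

lemma p_1: "p 1 = 0"
  using samm by (simp add: samm_sequence_def p_def)

lemma p_Suc: "1 \<le> k \<Longrightarrow> p (Suc k) = \<beta> k *\<^sub>R p k - \<tau>1 *\<^sub>R dir k"
  using samm by (simp add: samm_sequence_def p_def dir_def extrapolate_def)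

lemma w_nonneg: "0 \<le> w k"
  by (simp add: w_def)

lemma \<tau>1_L: "\<tau>1 * L * (1 + \<Gamma>) \<le> 1 / 4" "\<tau>1 * L * \<Gamma> \<le> 1 / 4"
proof -
  have "0 < \<tau>1 * L" using \<tau>1 L_pos by simp
  then show "\<tau>1 * L * (1 + \<Gamma>) \<le> 1 / 4" "\<tau>1 * L * \<Gamma> \<le> 1 / 4"
    using \<tau>1(3) \<omega>_less_1 by (auto simp: distrib_left)
qed

lemma \<beta>_p_le:
  assumes "1 \<le> k"
  shows "norm (\<beta> k *\<^sub>R p k) \<le> norm (p k)"
proof -
  have "B\<^sup>2 \<le> 1\<^sup>2"
    using \<omega>_pos \<nu> by (simp add: \<omega>_def)
  then have "B \<le> 1"
    by (rule power2_le_imp_le) simp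
  then have "\<beta> k \<le> 1"
    using \<beta>(2)[OF assms] by linarith
  then show ?thesis
    using \<beta>(1)[OF assms] by (simp add: mult_left_le_one_le)
qed

lemma extrapolate_close:
  assumes "norm (x k - xbar) < R" "norm (p k) < R" "0 \<le> c k" "c k \<le> \<Gamma>"
  shows "norm (extrapolate c x k - xbar) < \<rho> / 4"
proof -
  have "norm (extrapolate c x k - xbar) \<le> norm (x k - xbar) + norm (c k *\<^sub>R p k)"
    unfolding extrapolate_eq
    using norm_triangle_ineq[of "x k - xbar" "c k *\<^sub>R p k"] by (simp add: algebra_simps)
  also have "norm (c k *\<^sub>R p k) \<le> \<Gamma> * R"
    using assms B \<Gamma> by (auto intro!: mult_mono)
  finally show ?thesis
    using assms(1) \<Gamma>_R by (simp add: distrib_right)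
qed

text \<open>Extrapolated points lie within \<open>\<rho> / 4\<close> of \<open>xbar\<close>. Since
  \<open>g xbar = 0\<close> and \<open>\<tau>2 * L \<le> 1\<close>, the ascent perturbation at most
  doubles this distance, and the bound on \<open>\<tau>1\<close> then limits
  \<open>norm (p (Suc k))\<close> to \<open>3 / 2 * R\<close>. Thus all gradients are taken where
  \<open>lip\<close> holds.\<close>

lemma step_bounds:
  assumes k: "1 \<le> k" and xk: "norm (x k - xbar) < R" and pk: "norm (p k) < R"
  shows "extrapolate \<beta> x k \<in> ball xbar \<rho>" "extrapolate \<gamma> x k \<in> ball xbar \<rho>"
    and "x k \<in> ball xbar \<rho>" "x (Suc k) \<in> ball xbar \<rho>"
    and "norm (g (extrapolate \<gamma> x k) - dir k) \<le> \<nu> * norm (dir k)"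
    and "norm (g (extrapolate \<gamma> x k)) \<le> 2 * norm (dir k)"
proof -
  let ?u = "extrapolate \<gamma> x k"
  let ?v = "?u + \<tau>2 *\<^sub>R g ?u"
  have u: "norm (?u - xbar) < \<rho> / 4"
    by (rule extrapolate_close[OF xk pk]) (use \<gamma> k in auto)
  have "norm (extrapolate \<beta> x k - xbar) < \<rho> / 4"
    by (rule extrapolate_close[OF xk pk]) (use \<beta>(1)[OF k] order_trans[OF \<beta>(2)[OF k] \<Gamma>] in auto)
  then show "extrapolate \<beta> x k \<in> ball xbar \<rho>" and ub: "?u \<in> ball xbar \<rho>"
    and "x k \<in> ball xbar \<rho>"
    unfolding in_ball_iff using u xk R_le \<rho>_pos by auto
  have "\<tau>2 * L \<le> \<nu> / (\<nu> + 1)"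
    using mult_right_mono[OF \<tau>2(2), of L] L_pos by simp
  also have "\<dots> \<le> 1"
    using \<nu> by simp
  finally have \<tau>2L: "\<tau>2 * L \<le> 1" .
  have "norm (\<tau>2 *\<^sub>R g ?u) \<le> \<tau>2 * (L * norm (?u - xbar))"
    using norm_g_le[OF ub] \<tau>2 by (simp add: mult_left_mono)
  also have "\<dots> \<le> 1 * norm (?u - xbar)"
    unfolding mult.assoc[symmetric] using \<tau>2L by (intro mult_right_mono) auto
  finally have "norm (?v - xbar) < \<rho> / 2"
    using norm_triangle_ineq[of "?u - xbar" "\<tau>2 *\<^sub>R g ?u"] u by (simp add: algebra_simps)
  then have v: "norm (?v - xbar) \<le> 2 * ((1 + \<Gamma>) * R)" and vb: "?v \<in> ball xbar \<rho>"
    unfolding in_ball_iff \<Gamma>_R using \<rho>_pos by auto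
  have "norm (dir k) \<le> L * (2 * ((1 + \<Gamma>) * R))"
    unfolding dir_def
    using L_pos by (intro order_trans[OF norm_g_le[OF vb]] mult_left_mono v) auto
  then have "\<tau>1 * norm (dir k) \<le> \<tau>1 * (L * (2 * ((1 + \<Gamma>) * R)))"
    using \<tau>1 by (intro mult_left_mono) auto
  also have "\<dots> = \<tau>1 * L * (1 + \<Gamma>) * (2 * R)"
    by simp
  also have "\<dots> \<le> 1 / 4 * (2 * R)"
    using \<tau>1_L R_pos by (intro mult_right_mono) auto
  finally have 1: "norm (\<tau>1 *\<^sub>R dir k) \<le> R / 2"
    using \<tau>1 by simp
  have "norm (\<beta> k *\<^sub>R p k) \<le> R"
    using \<beta>_p_le[OF k] pk by linarith
  then have "norm (p (Suc k)) \<le> R + R / 2"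
    using 1 norm_triangle_ineq4[of "\<beta> k *\<^sub>R p k" "\<tau>1 *\<^sub>R dir k"] by (simp add: p_Suc[OF k])
  then have "norm (x (Suc k) - xbar) < \<rho>"
    using norm_triangle_ineq[of "x k - xbar" "p (Suc k)"] xk R_le R_pos by (simp add: p_def)
  then show "x (Suc k) \<in> ball xbar \<rho>"
    unfolding in_ball_iff .
  have "norm (dir k - g ?u) \<le> L * (\<tau>2 * norm (g ?u))"
    using lip[OF vb ub] \<tau>2 by (simp add: dir_def)
  then show "norm (g ?u - dir k) \<le> \<nu> * norm (dir k)" "norm (g ?u) \<le> 2 * norm (dir k)"
    using perturbed_gradient_bounds[of L \<nu> \<tau>2 "dir k" "g ?u"] L_pos \<nu> \<tau>2 by auto
qed

text \<open>If \<open>D k\<close> vanished, \<open>x k\<close> would be a minimizer in the ball with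
  \<open>p k = 0\<close>; the extrapolated point would equal \<open>x k\<close> and have zero
  gradient, contrary to \<open>nonzero\<close>.\<close>

lemma D_pos:
  assumes "1 \<le> k" "x k \<in> ball xbar \<rho>"
  shows "0 < D k"
proof -
  have nn: "0 \<le> f (x k) - f xbar" "0 \<le> A / (2 * \<tau>1) * (norm (p k))\<^sup>2"
    using minimal[OF assms(2)] A_bounds \<tau>1 by auto
  moreover have "D k \<noteq> 0"
  proof
    assume "D k = 0"
    then have "f (x k) = f xbar" "A / (2 * \<tau>1) * (norm (p k))\<^sup>2 = 0"
      using nn unfolding D_def by linarith+
    then have "g (x k) = 0" "p k = 0"
      using stationary_if_minimal[OF assms(2)] A_bounds \<tau>1 by auto
    then show False
      using nonzero[OF assms(1)] by (simp add: extrapolate_eq)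
  qed
  ultimately show ?thesis
    unfolding D_def by linarith
qed

text \<open>The descent estimate bounds the decrease of \<open>D\<close> below by
  \<open>(w k)\<^sup>2\<close>, while the PLK inequality bounds \<open>w k\<close> below through
  \<open>\<Phi>'\<close>. Multiplying both and using the tangent inequality for
  \<open>\<Phi>\<close> leaves \<open>w k\<close> to the first power.\<close>

lemma one_step:
  assumes k: "1 \<le> k" and xk: "norm (x k - xbar) < R" and pk: "norm (p k) < R" and D\<eta>: "D k < \<eta>0"
  shows "D (Suc k) \<le> D k - \<omega> / (16 * \<tau>1) * (w k)\<^sup>2"
    and "0 < D k" "0 < D (Suc k)" "D (Suc k) \<le> D k"
    and "\<tau>1 * norm (g (x k)) \<le> 3 * w k"
    and "\<tau>1 \<le> 6 * w k * \<Phi>' (D k)"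
    and "\<omega> / 96 * w k \<le> \<Phi> (D k) - \<Phi> (D (Suc k))"
proof -
  let ?G = "g (extrapolate \<gamma> x k)"
  note sb = step_bounds[OF k xk pk]
  show D0: "0 < D k" and D1: "0 < D (Suc k)"
    using D_pos sb k by auto
  have gG: "norm (g (x k) - ?G) \<le> L * (\<gamma> k * norm (p k))"
    using lip[OF sb(3) sb(2)] \<gamma>[OF k] by (simp add: extrapolate_eq)
  have fd: "f (x (Suc k)) \<le> f (x k) + inner (g (x k)) (p (Suc k)) + L * (norm (p (Suc k)))\<^sup>2"
    using gradient_descent_inequality[of "ball xbar \<rho>" f g L "x k" "x (Suc k)"] gderiv lip sb L_pos
    by (simp add: p_def)
  have "f (x (Suc k)) + A / (2 * \<tau>1) * (norm (p (Suc k)))\<^sup>2 + \<omega> / (16 * \<tau>1) * (w k)\<^sup>2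
      \<le> f (x k) + A / (2 * \<tau>1) * (norm (p k))\<^sup>2"
    by (rule momentum_step_descent[where d = "dir k" and G = "?G" and L = L and \<nu> = \<nu>
          and b = "\<beta> k" and B = B and c = "\<gamma> k" and \<Gamma> = \<Gamma> and h = "g (x k)"])
      (use \<nu> \<beta>[OF k] \<gamma>[OF k] L_pos \<tau>1 sb gG fd p_Suc[OF k] in \<open>auto simp: A_def \<omega>_def w_def\<close>)
  then show dec: "D (Suc k) \<le> D k - \<omega> / (16 * \<tau>1) * (w k)\<^sup>2"
    by (simp add: D_def)
  then show D10: "D (Suc k) \<le> D k"
    using \<omega>_pos \<tau>1 by (smt (verit) divide_nonneg_pos mult_nonneg_nonneg zero_le_power2)
  have "norm (\<tau>1 *\<^sub>R dir k) \<le> norm (\<beta> k *\<^sub>R p k) + norm (p (Suc k))"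
    using norm_triangle_ineq4[of "\<beta> k *\<^sub>R p k" "p (Suc k)"] p_Suc[OF k] by simp
  also have "norm (\<beta> k *\<^sub>R p k) \<le> norm (p k)"
    by (rule \<beta>_p_le[OF k])
  finally have td: "\<tau>1 * norm (dir k) \<le> w k"
    using \<tau>1 by (simp add: w_def)
  have "\<tau>1 * norm (g (x k) - ?G) \<le> \<tau>1 * (L * (\<Gamma> * norm (p k)))"
    using \<tau>1 L_pos \<gamma>[OF k]
    by (intro mult_left_mono order_trans[OF gG]) (auto intro!: mult_right_mono)
  also have "\<dots> = \<tau>1 * L * \<Gamma> * norm (p k)"
    by simp
  also have "\<dots> \<le> 1 / 4 * norm (p k)"
    using \<tau>1_L by (intro mult_right_mono) auto
  also have "\<dots> \<le> w k"
    by (simp add: w_def)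
  finally have 1: "\<tau>1 * norm (g (x k) - ?G) \<le> w k" .
  have "\<tau>1 * norm (g (x k)) \<le> \<tau>1 * (norm (g (x k) - ?G) + 2 * norm (dir k))"
    using sb(6) norm_triangle_ineq[of "g (x k) - ?G" "?G"] \<tau>1 by (intro mult_left_mono) auto
  also have "\<dots> = \<tau>1 * norm (g (x k) - ?G) + 2 * (\<tau>1 * norm (dir k))"
    by (simp add: algebra_simps)
  also have "\<dots> \<le> 3 * w k"
    using 1 td by simp
  finally show g3: "\<tau>1 * norm (g (x k)) \<le> 3 * w k" .
  define s where "s = A / (2 * \<tau>1) * (norm (p k))\<^sup>2"
  have Ds: "D k = f (x k) - f xbar + s" and s0: "0 \<le> s"
    using A_bounds \<tau>1 by (auto simp: D_def s_def)
  \<comment> \<open>The kinetic part of \<open>D k\<close> is controlled by \<open>w k\<close>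
    thanks to \<open>\<tau>1 \<le> 1\<close> and \<open>A \<le> 1\<close>.\<close>
  have "\<tau>1\<^sup>2 * s = \<tau>1 * A / 2 * (norm (p k))\<^sup>2"
    using \<tau>1 by (simp add: s_def power2_eq_square)
  also have "\<dots> \<le> 1 * (norm (p k))\<^sup>2"
    using A_bounds \<tau>1 mult_mono[of \<tau>1 1 A 1] by (intro mult_right_mono) auto
  finally have "sqrt (\<tau>1\<^sup>2 * s) \<le> sqrt ((norm (p k))\<^sup>2)"
    by (intro real_sqrt_le_mono) simp
  then have ts: "\<tau>1 * sqrt s \<le> w k"
    using \<tau>1(1) by (simp add: real_sqrt_mult w_def add_increasing2)
  have \<Phi>'D: "0 < \<Phi>' (D k)"
    using \<Phi>'_pos D0 D\<eta> by simp
  have "1 \<le> \<Phi>' (D k) * (norm (g (x k)) + 3 * sqrt s)"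
    using \<Phi>_grad[of "x k" s] sb(3) minimal s0 D0 D\<eta> unfolding Ds by simp
  then have "\<tau>1 * 1 \<le> \<tau>1 * (\<Phi>' (D k) * (norm (g (x k)) + 3 * sqrt s))"
    using \<tau>1 by (intro mult_left_mono) auto
  also have "\<dots> = \<Phi>' (D k) * (\<tau>1 * norm (g (x k)) + 3 * (\<tau>1 * sqrt s))"
    by (simp add: algebra_simps)
  also have "\<dots> \<le> \<Phi>' (D k) * (6 * w k)"
    using g3 ts \<Phi>'D by (intro mult_left_mono) auto
  finally show t6: "\<tau>1 \<le> 6 * w k * \<Phi>' (D k)"
    by (simp add: mult.commute)
  \<comment> \<open>The factor \<open>\<tau>1\<close> gained from the gradient cancels the
    \<open>1 / \<tau>1\<close> of the descent estimate, so the constant is independent of the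
    stepsize.\<close>
  have "\<omega> / 96 * w k = \<omega> / (96 * \<tau>1) * w k * \<tau>1"
    using \<tau>1 by simp
  also have "\<dots> \<le> \<omega> / (96 * \<tau>1) * w k * (6 * w k * \<Phi>' (D k))"
    using t6 \<omega>_pos \<tau>1 w_nonneg by (intro mult_left_mono) auto
  also have "\<dots> = \<Phi>' (D k) * (\<omega> / (16 * \<tau>1) * (w k)\<^sup>2)"
    by (simp add: power2_eq_square)
  also have "\<dots> \<le> \<Phi>' (D k) * (D k - D (Suc k))"
    using dec \<Phi>'D by (intro mult_left_mono) auto
  also have "\<dots> \<le> \<Phi> (D k) - \<Phi> (D (Suc k))"
    using D1 D10 D\<eta> by (intro \<Phi>_tangent) auto
  finally show "\<omega> / 96 * w k \<le> \<Phi> (D k) - \<Phi> (D (Suc k))" .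
qed

text \<open>The quantity \<open>\<omega> / 96 * norm (x k - xbar) + \<Phi> (D k)\<close> never
  increases, because each displacement is paid for by the decrease of \<open>\<Phi> (D k)\<close>.
  Carrying it through the induction keeps the hypotheses of \<open>one_step\<close> valid.\<close>

lemma trapped:
  assumes "1 \<le> k"
  shows "norm (x k - xbar) < R \<and> norm (p k) < R \<and> 0 < D k \<and> D k < \<eta>0 \<and>
    \<omega> / 96 * norm (x k - xbar) + \<Phi> (D k) < \<omega> / 96 * R"
  using assms
proof (induction k rule: dec_induct)
  case base
  have x1: "norm (x 1 - xbar) < R"
    using start_\<rho> by (simp add: R_def)
  then have "0 < D 1"
    using R_le \<rho>_pos by (intro D_pos, simp, unfold in_ball_iff) linarith
  moreover have "D 1 = f (x 1) - f xbar"
    using p_1 by (simp add: D_def)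
  ultimately show ?case
    using start x1 p_1 R_pos by (simp add: R_def)
next
  case (step k)
  then have k: "1 \<le> k" by simp
  note st = one_step[OF k]
  have le: "\<omega> / 96 * w k \<le> \<Phi> (D k) - \<Phi> (D (Suc k))"
    and D: "0 < D (Suc k)" "D (Suc k) \<le> D k"
    using st step by auto
  have \<Phi>0: "0 \<le> \<Phi> (D (Suc k))"
    using \<Phi>_nonneg D step by simp
  have c: "0 < \<omega> / 96" using \<omega>_pos by simp
  have pw: "\<omega> / 96 * norm (p (Suc k)) \<le> \<omega> / 96 * w k"
    using c by (intro mult_left_mono) (auto simp: w_def)
  have "norm (x (Suc k) - xbar) \<le> norm (x k - xbar) + norm (p (Suc k))"
    using norm_triangle_ineq[of "x k - xbar" "p (Suc k)"] by (simp add: p_def)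
  then have "\<omega> / 96 * norm (x (Suc k) - xbar) \<le> \<omega> / 96 * (norm (x k - xbar) + norm (p (Suc k)))"
    using c by (intro mult_left_mono) auto
  then have inv: "\<omega> / 96 * norm (x (Suc k) - xbar) + \<Phi> (D (Suc k)) < \<omega> / 96 * R"
    using le pw step by (simp add: distrib_left)
  then have "\<omega> / 96 * norm (x (Suc k) - xbar) < \<omega> / 96 * R"
    using \<Phi>0 by linarith
  \<comment> \<open>A single displacement costs at most \<open>\<Phi> (D k)\<close>, which by the
    invariant is itself below \<open>\<omega> / 96 * R\<close>.\<close>
  moreover have "\<omega> / 96 * norm (p (Suc k)) < \<omega> / 96 * R"
  proof -
    have "0 \<le> \<omega> / 96 * norm (x k - xbar)" using c by simp
    then show ?thesis
      using le pw step \<Phi>0 by linarith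
  qed
  ultimately show ?case
    using inv D step c by (simp add: mult_less_cancel_left_pos)
qed

lemma trapped_step:
  assumes k: "1 \<le> k"
  shows "D (Suc k) \<le> D k - \<omega> / (16 * \<tau>1) * (w k)\<^sup>2"
    and "D (Suc k) \<le> D k"
    and "\<tau>1 * norm (g (x k)) \<le> 3 * w k"
    and "\<tau>1 \<le> 6 * w k * \<Phi>' (D k)"
    and "\<omega> / 96 * w k \<le> \<Phi> (D k) - \<Phi> (D (Suc k))"
  using one_step[OF k] trapped[OF k] by auto

lemma iterates_in_ball: "x k \<in> ball xbar \<rho>"
proof (cases k)
  case 0
  then show ?thesis
    using samm step_bounds(3)[of 1] trapped[of 1] by (simp add: samm_sequence_def)
next
  case (Suc j)
  then show ?thesis
    using step_bounds(3)[of k] trapped[of k] by simp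
qed

lemma extrapolates_in_ball:
  assumes "1 \<le> k"
  shows "extrapolate \<beta> x k \<in> ball xbar \<rho>" "extrapolate \<gamma> x k \<in> ball xbar \<rho>"
  using step_bounds(1,2)[OF assms] trapped[OF assms] by auto

section \<open>Finite length and the limit point\<close>

lemma \<Phi>_D_nonneg: "1 \<le> k \<Longrightarrow> 0 \<le> \<Phi> (D k)"
  using trapped \<Phi>_nonneg by blast

lemma dist_iterates_le:
  assumes "1 \<le> m" "m \<le> n"
  shows "\<omega> / 96 * norm (x n - x m) \<le> \<Phi> (D m) - \<Phi> (D n)"
  using assms(2)
proof (induction n rule: dec_induct)
  case base
  then show ?case by simp
next
  case (step n)
  have "norm (x (Suc n) - x m) \<le> norm (x n - x m) + w n"
  proof -
    have "norm (p (Suc n)) \<le> w n" by (simp add: w_def)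
    then show ?thesis
      using norm_triangle_ineq[of "x n - x m" "p (Suc n)"] by (simp add: p_def)
  qed
  then have "\<omega> / 96 * norm (x (Suc n) - x m) \<le> \<omega> / 96 * (norm (x n - x m) + w n)"
    using \<omega>_pos by (intro mult_left_mono) auto
  then show ?case
    using step trapped_step(5)[of n] assms(1) by (simp add: distrib_left)
qed

text \<open>The values \<open>\<Phi> (D k)\<close> decrease and are nonnegative, hence form a Cauchy
  sequence, and their differences dominate the distances of the iterates. The shift by
  \<open>Suc\<close> skips index 0.\<close>

lemma iterates_Cauchy: "Cauchy x"
proof -
  have dec: "decseq (\<lambda>k. \<Phi> (D (Suc k)))"
  proof (rule decseq_SucI)
    fix k
    have "0 \<le> \<omega> / 96 * w (Suc k)"
      using \<omega>_pos w_nonneg by simp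
    then show "\<Phi> (D (Suc (Suc k))) \<le> \<Phi> (D (Suc k))"
      using trapped_step(5)[of "Suc k"] by simp
  qed
  have "\<forall>k. 0 \<le> \<Phi> (D (Suc k))"
    using \<Phi>_D_nonneg by simp
  then obtain l where "(\<lambda>k. \<Phi> (D (Suc k))) \<longlonglongrightarrow> l"
    using decseq_convergent[OF dec] by blast
  then have C: "Cauchy (\<lambda>k. \<Phi> (D (Suc k)))"
    by (rule LIMSEQ_imp_Cauchy)
  have "Cauchy (\<lambda>k. x (Suc k))"
  proof (rule CauchyI')
    fix e :: real assume "0 < e"
    then have "0 < \<omega> / 96 * e" using \<omega>_pos by simp
    then obtain N where N: "\<And>m n. N \<le> m \<Longrightarrow> N \<le> n \<Longrightarrow> \<bar>\<Phi> (D (Suc m)) - \<Phi> (D (Suc n))\<bar> < \<omega> / 96 * e"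
      using CauchyD[OF C] by (metis real_norm_def)
    have "norm (x (Suc m) - x (Suc n)) < e" if "N \<le> m" "m < n" for m n
    proof -
      have "\<omega> / 96 * norm (x (Suc n) - x (Suc m)) < \<omega> / 96 * e"
        using dist_iterates_le[of "Suc m" "Suc n"] N[of m n] that
          abs_ge_self[of "\<Phi> (D (Suc m)) - \<Phi> (D (Suc n))"] by linarith
      then show ?thesis
        using \<omega>_pos by (simp add: norm_minus_commute)
    qed
    then show "\<exists>M. \<forall>m\<ge>M. \<forall>n>m. dist (x (Suc m)) (x (Suc n)) < e"
      unfolding dist_norm by blast
  qed
  then have "convergent (\<lambda>k. x (Suc k))"
    by (rule Cauchy_convergent)
  then show ?thesis
    by (simp add: convergent_Suc_iff convergent_Cauchy)
qed

definition "xt = lim x"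

lemma x_tendsto: "x \<longlonglongrightarrow> xt"
  using iterates_Cauchy by (simp add: xt_def Cauchy_convergent_iff convergent_LIMSEQ_iff)

lemma p_tendsto: "p \<longlonglongrightarrow> 0"
proof -
  have "(\<lambda>k. x (Suc k) - x k) \<longlonglongrightarrow> xt - xt"
    by (intro tendsto_diff x_tendsto LIMSEQ_Suc)
  then have "(\<lambda>k. p (Suc k)) \<longlonglongrightarrow> 0"
    by (simp add: p_def)
  then show ?thesis
    by (rule LIMSEQ_imp_Suc)
qed

lemma extrapolate_tendsto:
  assumes "\<And>k. 1 \<le> k \<Longrightarrow> 0 \<le> c k" "\<And>k. 1 \<le> k \<Longrightarrow> c k \<le> \<Gamma>"
  shows "extrapolate c x \<longlonglongrightarrow> xt"
proof -
  have "(\<lambda>k. c k *\<^sub>R p k) \<longlonglongrightarrow> 0"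
  proof (rule Lim_null_comparison)
    show "\<forall>\<^sub>F k in sequentially. norm (c k *\<^sub>R p k) \<le> \<Gamma> * norm (p k)"
      using assms by (auto intro!: eventually_sequentiallyI[of 1] mult_right_mono)
    show "(\<lambda>k. \<Gamma> * norm (p k)) \<longlonglongrightarrow> 0"
      by (intro tendsto_mult_right_zero tendsto_norm_zero p_tendsto)
  qed
  then have "(\<lambda>k. x k + c k *\<^sub>R p k) \<longlonglongrightarrow> xt + 0"
    by (intro tendsto_add x_tendsto)
  then show ?thesis
    by (simp add: extrapolate_eq[abs_def])
qed

text \<open>Let \<open>n\<close> tend to infinity in \<open>dist_iterates_le\<close> after dropping
  \<open>\<Phi> (D n) \<ge> 0\<close>. This converts decay of \<open>D\<close> into decay of the
  distance to the limit.\<close>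

lemma dist_limit_le:
  assumes "1 \<le> k"
  shows "\<omega> / 96 * norm (x k - xt) \<le> \<Phi> (D k)"
proof (rule LIMSEQ_le_const2)
  show "(\<lambda>n. \<omega> / 96 * norm (x k - x n)) \<longlonglongrightarrow> \<omega> / 96 * norm (x k - xt)"
    by (intro tendsto_intros x_tendsto)
  show "\<exists>N. \<forall>n\<ge>N. \<omega> / 96 * norm (x k - x n) \<le> \<Phi> (D k)"
  proof (intro exI allI impI)
    fix n assume "k \<le> n"
    then show "\<omega> / 96 * norm (x k - x n) \<le> \<Phi> (D k)"
      using dist_iterates_le[OF assms, of n] \<Phi>_D_nonneg[of n] assms
      unfolding norm_minus_commute[of "x k"] by linarith
  qed
qed

lemma xt_in_ball: "xt \<in> ball xbar \<rho>"
proof -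
  have "norm (xt - xbar) \<le> R"
  proof (rule LIMSEQ_le_const2)
    show "(\<lambda>n. norm (x n - xbar)) \<longlonglongrightarrow> norm (xt - xbar)"
      by (intro tendsto_intros x_tendsto)
    show "\<exists>N. \<forall>n\<ge>N. norm (x n - xbar) \<le> R"
      using trapped by (intro exI[of _ 1]) (auto intro: less_imp_le)
  qed
  then show ?thesis
    unfolding in_ball_iff using R_le \<rho>_pos by linarith
qed

text \<open>By \<open>trapped_step\<close> the gradients at the iterates are bounded by
  \<open>3 / \<tau>1 * w k\<close>, which tends to 0.\<close>

lemma g_xt: "g xt = 0"
proof -
  have "isCont g xt"
  proof -
    have "L-lipschitz_on (ball xbar \<rho>) g"
      using lip L_pos by (intro lipschitz_onI) (auto simp: dist_norm)
    then show ?thesis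
      using lipschitz_on_continuous_on xt_in_ball continuous_on_eq_continuous_at open_ball by blast
  qed
  then have "(\<lambda>k. norm (g (x k))) \<longlonglongrightarrow> norm (g xt)"
    by (intro tendsto_norm isCont_tendsto_compose[OF _ x_tendsto])
  moreover have "(\<lambda>k. norm (g (x k))) \<longlonglongrightarrow> 0"
  proof (rule Lim_null_comparison)
    show "\<forall>\<^sub>F k in sequentially. norm (norm (g (x k))) \<le> 3 / \<tau>1 * w k"
      using trapped_step(3) \<tau>1
      by (auto intro!: eventually_sequentiallyI[of 1] simp: field_simps)
    have "(\<lambda>k. 3 / \<tau>1 * (norm (p k) + norm (p (Suc k)))) \<longlonglongrightarrow> 3 / \<tau>1 * (norm (0::'a) + norm (0::'a))"
      by (intro tendsto_intros p_tendsto LIMSEQ_Suc)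
    then show "(\<lambda>k. 3 / \<tau>1 * w k) \<longlonglongrightarrow> 0"
      by (simp add: w_def[abs_def])
  qed
  ultimately show ?thesis
    using LIMSEQ_unique by fastforce
qed

lemma D_le_D1: "1 \<le> k \<Longrightarrow> D k \<le> D 1"
proof (induction k rule: dec_induct)
  case (step k)
  then show ?case using trapped_step(2)[of k] by simp
qed simp

text \<open>Otherwise the PLK inequality applies at \<open>xt\<close> with \<open>s = 0\<close>, as
  \<open>f xt - f xbar \<le> D 1 < \<eta>0\<close>; it contradicts \<open>g xt = 0\<close>.\<close>

lemma f_xt: "f xt = f xbar"
proof (rule ccontr)
  assume "f xt \<noteq> f xbar"
  then have gt: "f xbar < f xt"
    using minimal[OF xt_in_ball] by simp
  have "isCont f xt"
    using gderiv[OF xt_in_ball] by (auto simp: gderiv_def intro: has_derivative_continuous)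
  then have "(\<lambda>k. f (x k) - f xbar) \<longlonglongrightarrow> f xt - f xbar"
    by (intro tendsto_intros isCont_tendsto_compose[OF _ x_tendsto])
  then have "f xt - f xbar \<le> D 1"
  proof (rule LIMSEQ_le_const2)
    have "f (x k) - f xbar \<le> D 1" if "1 \<le> k" for k
    proof -
      have "0 \<le> A / (2 * \<tau>1) * (norm (p k))\<^sup>2"
        using A_bounds \<tau>1 by simp
      then show ?thesis
        using D_le_D1[OF that] by (simp add: D_def)
    qed
    then show "\<exists>N. \<forall>k\<ge>N. f (x k) - f xbar \<le> D 1" by blast
  qed
  then have "1 \<le> \<Phi>' (f xt - f xbar + 0) * (norm (g xt) + 3 * sqrt 0)"
    using trapped[of 1] gt xt_in_ball by (intro \<Phi>_grad) auto
  then show False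
    using g_xt by simp
qed

lemma xt_local_minimizer:
  assumes "ball xbar \<rho> \<subseteq> X"
  shows "local_minimizer X f xt"
proof -
  obtain e where "0 < e" "ball xt e \<subseteq> ball xbar \<rho>"
    using openE[OF open_ball xt_in_ball] .
  then show ?thesis
    unfolding local_minimizer_def f_xt using assms xt_in_ball minimal by blast
qed

section \<open>Convergence rates\<close>

lemma norm_g_iterates_le: "norm (g (x k)) \<le> L * norm (x k - xt)"
  using lip[OF iterates_in_ball xt_in_ball, of k] g_xt by simp

text \<open>The linear term of the descent inequality vanishes at \<open>xt\<close>. The quadratic
  bound is why function values converge at the squared rate.\<close>

lemma f_iterates_le: "0 \<le> f (x k) - f xt" "f (x k) - f xt \<le> L * (norm (x k - xt))\<^sup>2"
  using gradient_descent_inequality[of "ball xbar \<rho>" f g L xt "x k"] gderiv lip L_pos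
    iterates_in_ball xt_in_ball g_xt minimal[OF iterates_in_ball] f_xt by auto

text \<open>The bound on \<open>\<Phi>'\<close> turns the PLK estimate into a lower bound of
  \<open>w k\<close> by a multiple of \<open>D k powr q\<close>, which is inserted into the decrease
  of \<open>D\<close>. The constant \<open>c\<close> may depend on \<open>\<tau>1\<close>, since the
  rates concern one trajectory.\<close>

lemma energy_recursion:
  assumes "0 < C" and C: "\<And>u. 0 < u \<Longrightarrow> u < \<eta>0 \<Longrightarrow> \<Phi>' u \<le> C * u powr (- q)"
  obtains c where "0 < c" "\<And>k. 1 \<le> k \<Longrightarrow> D (Suc k) \<le> D k - c * D k powr (2 * q)"
proof -
  define e where "e = \<tau>1 / (6 * C)"
  have e: "0 < e" using \<tau>1 assms by (simp add: e_def)
  have "D (Suc k) \<le> D k - \<omega> / (16 * \<tau>1) * e\<^sup>2 * D k powr (2 * q)" if k: "1 \<le> k" for k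
  proof -
    have D: "0 < D k" "D k < \<eta>0" using trapped[OF k] by auto
    have "\<tau>1 \<le> 6 * w k * \<Phi>' (D k)"
      by (rule trapped_step(4)[OF k])
    also have "\<dots> \<le> 6 * w k * (C * D k powr (- q))"
      using C[OF D] w_nonneg by (intro mult_left_mono) auto
    finally have "e \<le> w k * D k powr (- q)"
      using assms(1) by (simp add: e_def field_simps)
    then have "e * D k powr q \<le> w k"
      using D by (simp add: powr_minus field_simps)
    then have "(e * D k powr q)\<^sup>2 \<le> (w k)\<^sup>2"
      using e by (intro power_mono) auto
    moreover have "(e * D k powr q)\<^sup>2 = e\<^sup>2 * D k powr (2 * q)"
      by (simp add: power_mult_distrib power2_eq_square flip: powr_add)
    ultimately have "\<omega> / (16 * \<tau>1) * (e\<^sup>2 * D k powr (2 * q)) \<le> \<omega> / (16 * \<tau>1) * (w k)\<^sup>2"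
      using \<omega>_pos \<tau>1 by (intro mult_left_mono) auto
    then show ?thesis
      using trapped_step(1)[OF k] by simp
  qed
  then show thesis
    using e \<omega>_pos \<tau>1 by (intro that[of "\<omega> / (16 * \<tau>1) * e\<^sup>2"]) auto
qed

lemma rates_from_distance:
  fixes b :: "nat \<Rightarrow> real"
  assumes "\<And>k. 1 \<le> k \<Longrightarrow> 0 \<le> b k" "\<And>k. 1 \<le> k \<Longrightarrow> norm (x k - xt) \<le> K * b k"
  shows "(\<lambda>k. norm (x k - xt)) \<in> O(b)" "(\<lambda>k. norm (g (x k))) \<in> O(b)"
    and "(\<lambda>k. f (x k) - f xt) \<in> O(\<lambda>k. (b k)\<^sup>2)"
proof -
  show 1: "(\<lambda>k. norm (x k - xt)) \<in> O(b)"
    using assms by (intro bigoI[of _ K] eventually_sequentiallyI[of 1]) auto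
  have "(\<lambda>k. norm (g (x k))) \<in> O(\<lambda>k. norm (x k - xt))"
    using norm_g_iterates_le by (intro bigoI[of _ L] always_eventually) auto
  then show "(\<lambda>k. norm (g (x k))) \<in> O(b)"
    using 1 by (rule landau_o.big_trans)
  have "(\<lambda>k. f (x k) - f xt) \<in> O(\<lambda>k. (norm (x k - xt))\<^sup>2)"
    using f_iterates_le by (intro bigoI[of _ L] always_eventually) auto
  also have "(\<lambda>k. (norm (x k - xt))\<^sup>2) \<in> O(\<lambda>k. (b k)\<^sup>2)"
    by (rule landau_o.big_power[OF 1])
  finally show "(\<lambda>k. f (x k) - f xt) \<in> O(\<lambda>k. (b k)\<^sup>2)" .
qed

lemma distance_from_energy:
  assumes C: "\<And>u. 0 < u \<Longrightarrow> u < \<eta>0 \<Longrightarrow> \<Phi> u \<le> C * u powr (1 - q)" and "1 \<le> k"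
  shows "norm (x k - xt) \<le> 96 / \<omega> * C * D k powr (1 - q)"
proof -
  have "\<omega> / 96 * norm (x k - xt) \<le> C * D k powr (1 - q)"
    using dist_limit_le[OF assms(2)] C[of "D k"] trapped[OF assms(2)] by linarith
  then show ?thesis
    using \<omega>_pos by (simp add: field_simps)
qed

text \<open>For exponent 1/2 the recursion for \<open>D\<close> is linear. The distance is bounded
  by a multiple of \<open>sqrt (D k)\<close> and so decays with ratio \<open>sqrt \<mu>\<close>;
  squaring returns the ratio \<open>\<mu>\<close> for the function values.\<close>

lemma linear_rates:
  assumes "0 < C" and C1: "\<And>u. 0 < u \<Longrightarrow> u < \<eta>0 \<Longrightarrow> \<Phi> u \<le> C * u powr (1 - 1 / 2)"
    and C2: "\<And>u. 0 < u \<Longrightarrow> u < \<eta>0 \<Longrightarrow> \<Phi>' u \<le> C * u powr (- (1 / 2))"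
  shows "converges_linearly x xt" "converges_linearly (\<lambda>k. g (x k)) 0"
    "converges_linearly (\<lambda>k. f (x k)) (f xt)"
proof -
  obtain c where c: "0 < c" "\<And>k. 1 \<le> k \<Longrightarrow> D (Suc k) \<le> D k - c * D k powr (2 * (1 / 2))"
    using energy_recursion[OF assms(1) C2] by blast
  have Dp: "0 < D k" if "1 \<le> k" for k using trapped[OF that] by simp
  have "D (Suc k) \<le> D k - c * D k" if "1 \<le> k" for k
    using c(2)[OF that] Dp[OF that] by simp
  then obtain \<mu> K where \<mu>: "0 < \<mu>" "\<mu> < 1" "0 < K" "\<And>k. 1 \<le> k \<Longrightarrow> D k \<le> K * \<mu> ^ k"
    using linear_decay_recursion[of D c] Dp c(1) by blast
  have b: "norm (x k - xt) \<le> 96 / \<omega> * C * sqrt K * sqrt \<mu> ^ k" if "1 \<le> k" for k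
  proof -
    have "D k powr (1 - 1 / 2) = sqrt (D k)"
      using Dp[OF that] by (simp add: powr_half_sqrt)
    also have "\<dots> \<le> sqrt (K * \<mu> ^ k)"
      using \<mu>(4)[OF that] by simp
    also have "\<dots> = sqrt K * sqrt \<mu> ^ k"
      by (simp add: real_sqrt_mult real_sqrt_power)
    finally have "96 / \<omega> * C * D k powr (1 - 1 / 2) \<le> 96 / \<omega> * C * (sqrt K * sqrt \<mu> ^ k)"
      using \<omega>_pos assms(1) by (intro mult_left_mono) auto
    then show ?thesis
      using distance_from_energy[OF C1 that] by simp
  qed
  note r = rates_from_distance[of "\<lambda>k. sqrt \<mu> ^ k", OF _ b]
  have s: "sqrt \<mu> \<in> {0<..<1}" "\<mu> \<in> {0<..<1}" using \<mu> by auto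
  show "converges_linearly x xt" "converges_linearly (\<lambda>k. g (x k)) 0"
    unfolding converges_linearly_def using r(1,2) s(1) \<mu> by auto
  have "(\<lambda>k. (sqrt \<mu> ^ k)\<^sup>2) = (\<lambda>k. \<mu> ^ k)"
    using \<mu> by (simp add: power2_eq_square flip: power_mult_distrib)
  then show "converges_linearly (\<lambda>k. f (x k)) (f xt)"
    unfolding converges_linearly_def using r(3) s(2) \<mu>
    by (intro bexI[of _ \<mu>]) (auto simp: landau_o.big.norm_iff)
qed

lemma sublinear_rates:
  assumes "0 < C" "1 / 2 < q" "q < 1"
    and C1: "\<And>u. 0 < u \<Longrightarrow> u < \<eta>0 \<Longrightarrow> \<Phi> u \<le> C * u powr (1 - q)"
    and C2: "\<And>u. 0 < u \<Longrightarrow> u < \<eta>0 \<Longrightarrow> \<Phi>' u \<le> C * u powr (- q)"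
  shows "(\<lambda>k. norm (x k - xt)) \<in> O(\<lambda>k. real k powr (- ((1 - q) / (2 * q - 1))))"
    "(\<lambda>k. norm (g (x k))) \<in> O(\<lambda>k. real k powr (- ((1 - q) / (2 * q - 1))))"
    "(\<lambda>k. f (x k) - f xt) \<in> O(\<lambda>k. real k powr (- ((2 - 2 * q) / (2 * q - 1))))"
proof -
  obtain c where c: "0 < c" "\<And>k. 1 \<le> k \<Longrightarrow> D (Suc k) \<le> D k - c * D k powr (2 * q)"
    using energy_recursion[OF assms(1) C2] by blast
  have Dp: "0 < D k" if "1 \<le> k" for k using trapped[OF that] by simp
  \<comment> \<open>The exponent \<open>2 * q\<close> of the recursion is \<open>1 + s\<close> with
    \<open>s = 2 * q - 1\<close>, positive because \<open>1 / 2 < q\<close>.\<close>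
  obtain K where K: "0 < K" "\<And>k. 1 \<le> k \<Longrightarrow> D k \<le> K * real k powr (- 1 / (2 * q - 1))"
    using sublinear_decay_recursion[of D c "2 * q - 1"] Dp c assms(2) by auto
  let ?b = "\<lambda>k. real k powr (- ((1 - q) / (2 * q - 1)))"
  have b: "norm (x k - xt) \<le> 96 / \<omega> * C * K powr (1 - q) * ?b k" if "1 \<le> k" for k
  proof -
    have "D k powr (1 - q) \<le> (K * real k powr (- 1 / (2 * q - 1))) powr (1 - q)"
      using K(2)[OF that] Dp[OF that] assms(3) by (intro powr_mono2) auto
    also have "\<dots> = K powr (1 - q) * ?b k"
      using K(1) by (simp add: powr_mult powr_powr)
    finally have "96 / \<omega> * C * D k powr (1 - q) \<le> 96 / \<omega> * C * (K powr (1 - q) * ?b k)"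
      using \<omega>_pos assms(1) by (intro mult_left_mono) auto
    then show ?thesis
      using distance_from_energy[OF C1 that] by simp
  qed
  note r = rates_from_distance[of ?b, OF _ b]
  show "(\<lambda>k. norm (x k - xt)) \<in> O(?b)" "(\<lambda>k. norm (g (x k))) \<in> O(?b)"
    using r(1,2) by auto
  have "(\<lambda>k. (?b k)\<^sup>2) = (\<lambda>k. real k powr (- ((2 - 2 * q) / (2 * q - 1))))"
    by (simp add: power2_eq_square diff_divide_distrib flip: powr_add)
  then show "(\<lambda>k. f (x k) - f xt) \<in> O(\<lambda>k. real k powr (- ((2 - 2 * q) / (2 * q - 1))))"
    using r(3) by simp
qed

end

section \<open>Choice of the starting radius and the stepsize bound\<close>

theorem theorem4p4:
  fixes xbar :: "real ^ 'n" and r L \<nu> :: real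
    and f :: "real ^ 'n \<Rightarrow> real" and g :: "real ^ 'n \<Rightarrow> real ^ 'n"
    and \<eta> :: ereal and \<psi> :: "real \<Rightarrow> real" and \<beta> \<gamma> :: "nat \<Rightarrow> real"
  defines "X \<equiv> ball xbar r"
  assumes "r > 0" and "L > 0"
    and "\<forall>x\<in>X. GDERIV f x :> g x"
    and "continuous_on X g"
    and "\<forall>x\<in>X. \<forall>y\<in>X. norm (g x - g y) \<le> L * norm (x - y)"
    and "local_minimizer X f xbar"
    and "plk_condition X f g xbar \<eta> \<psi>"
    and "\<nu> \<in> {0<..<1}"
    and "\<forall>k\<ge>1. 0 \<le> \<beta> k" and "\<forall>k\<ge>1. 0 \<le> \<gamma> k"
    and "bdd_above (\<beta> ` {1..})"
    and "(SUP k\<in>{1..}. \<beta> k) \<in> {0..<sqrt (1 - \<nu>)}"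
    and "bdd_above ((\<lambda>k. \<bar>\<beta> k - \<gamma> k\<bar>) ` {1..})"
  shows "\<exists>\<xi>\<in>{0<..r}. \<exists>T>0.
    \<forall>x. \<forall>\<tau>1\<in>{0<..T}. \<forall>\<tau>2\<in>{0..\<nu> / (L * (\<nu> + 1))}.
      x 1 \<in> ball xbar \<xi> \<longrightarrow>
      samm_sequence g \<beta> \<gamma> \<tau>1 \<tau>2 x \<longrightarrow>
      (\<forall>k\<ge>1. g (extrapolate \<gamma> x k) \<noteq> 0) \<longrightarrow>
      (\<forall>k. x k \<in> X) \<and>
      (\<forall>k\<ge>1. extrapolate \<beta> x k \<in> X \<and> extrapolate \<gamma> x k \<in> X) \<and>
      (\<exists>xt\<in>X. local_minimizer X f xt \<and> f xt = f xbar \<and>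
        x \<longlonglongrightarrow> xt \<and>
        extrapolate \<beta> x \<longlonglongrightarrow> xt \<and>
        extrapolate \<gamma> x \<longlonglongrightarrow> xt \<and>
        (\<forall>M>0. \<forall>q\<in>{0<..<1}.
          (\<forall>t. 0 \<le> t \<and> ereal t < \<eta> \<longrightarrow> \<psi> t = M * t powr (1 - q)) \<longrightarrow>
          (q = 1/2 \<longrightarrow>
             converges_linearly x xt \<and>
             converges_linearly (\<lambda>k. g (x k)) 0 \<and>
             converges_linearly (\<lambda>k. f (x k)) (f xt)) \<and>
          (1/2 < q \<longrightarrow>
             (\<lambda>k. norm (x k - xt)) \<in> O(\<lambda>k. real k powr (- ((1 - q) / (2 * q - 1)))) \<and>
             (\<lambda>k. norm (g (x k))) \<in> O(\<lambda>k. real k powr (- ((1 - q) / (2 * q - 1)))) \<and>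
             (\<lambda>k. f (x k) - f xt) \<in> O(\<lambda>k. real k powr (- ((2 - 2 * q) / (2 * q - 1)))))))"
proof -
  from assms have r: "0 < r" and L: "0 < L" and gd: "\<And>z. z \<in> X \<Longrightarrow> GDERIV f z :> g z"
    and lip: "\<And>u v. u \<in> X \<Longrightarrow> v \<in> X \<Longrightarrow> norm (g u - g v) \<le> L * norm (u - v)"
    and locmin: "local_minimizer X f xbar" and plk: "plk_condition X f g xbar \<eta> \<psi>"
    and \<nu>: "0 < \<nu>" "\<nu> < 1"
    and \<beta>0: "\<And>k. 1 \<le> k \<Longrightarrow> 0 \<le> \<beta> k" and \<gamma>0: "\<And>k. 1 \<le> k \<Longrightarrow> 0 \<le> \<gamma> k"
    and bdd\<beta>: "bdd_above (\<beta> ` {1..})"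
    and sup\<beta>: "0 \<le> (SUP k\<in>{1..}. \<beta> k)" "(SUP k\<in>{1..}. \<beta> k) < sqrt (1 - \<nu>)"
    and bdd\<delta>: "bdd_above ((\<lambda>k. \<bar>\<beta> k - \<gamma> k\<bar>) ` {1..})"
    by auto
  obtain \<eta>0 \<rho>1 \<Phi> \<Phi>'
    where \<eta>0: "0 < \<eta>0" and \<rho>1: "0 < \<rho>1"
    and \<Phi>_nonneg: "\<And>u. 0 < u \<Longrightarrow> u < \<eta>0 \<Longrightarrow> 0 \<le> \<Phi> u"
    and \<Phi>'_pos: "\<And>u. 0 < u \<Longrightarrow> u < \<eta>0 \<Longrightarrow> 0 < \<Phi>' u"
    and \<Phi>_tangent: "\<And>u v. 0 < v \<Longrightarrow> v \<le> u \<Longrightarrow> u < \<eta>0 \<Longrightarrow> \<Phi>' u * (u - v) \<le> \<Phi> u - \<Phi> v"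
    and \<Phi>_lim: "(\<Phi> \<longlongrightarrow> 0) (at_right 0)"
    and \<Phi>_grad: "\<And>z s. z \<in> ball xbar \<rho>1 \<Longrightarrow> f xbar \<le> f z \<Longrightarrow> 0 \<le> s \<Longrightarrow> 0 < f z - f xbar + s \<Longrightarrow>
      f z - f xbar + s < \<eta>0 \<Longrightarrow> 1 \<le> \<Phi>' (f z - f xbar + s) * (norm (g z) + 3 * sqrt s)"
    and \<Phi>_power: "\<And>M q. 0 < M \<Longrightarrow> 1 / 2 \<le> q \<Longrightarrow> q < 1 \<Longrightarrow>
      \<forall>t. 0 \<le> t \<and> ereal t < \<eta> \<longrightarrow> \<psi> t = M * t powr (1 - q) \<Longrightarrow>
      \<exists>C>0. \<forall>u\<in>{0<..<\<eta>0}. \<Phi> u \<le> C * u powr (1 - q) \<and> \<Phi>' u \<le> C * u powr (- q)"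
    apply (rule plk_merit_function[OF plk])
    subgoal for \<eta>0 \<rho>1 \<Phi> \<Phi>' by (rule that[of \<eta>0 \<rho>1 \<Phi> \<Phi>'])
    done
  obtain e where e: "0 < e" "\<And>y. y \<in> X \<Longrightarrow> y \<in> ball xbar e \<Longrightarrow> f xbar \<le> f y"
    using locmin by (auto simp: local_minimizer_def)
  \<comment> \<open>On this ball the gradient is Lipschitz, the modified PLK inequality holds and
    \<open>xbar\<close> is a minimizer.\<close>
  define \<rho> where "\<rho> = min r (min \<rho>1 e)"
  have \<rho>: "0 < \<rho>" "ball xbar \<rho> \<subseteq> X" "ball xbar \<rho> \<subseteq> ball xbar \<rho>1" "ball xbar \<rho> \<subseteq> ball xbar e"
    using r \<rho>1 e by (auto simp: \<rho>_def X_def)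
  define B where "B = (SUP k\<in>{1..}. \<beta> k)"
  \<comment> \<open>A common bound for both kinds of extrapolation coefficients.\<close>
  define \<Gamma> where "\<Gamma> = B + (SUP k\<in>{1..}. \<bar>\<beta> k - \<gamma> k\<bar>)"
  define \<omega> where "\<omega> = 1 - \<nu> - B\<^sup>2"
  have \<beta>B: "\<beta> k \<le> B" if "1 \<le> k" for k
    unfolding B_def using that bdd\<beta> by (intro cSUP_upper) auto
  have \<delta>: "\<bar>\<beta> k - \<gamma> k\<bar> \<le> (SUP k\<in>{1..}. \<bar>\<beta> k - \<gamma> k\<bar>)" if "1 \<le> k" for k
    using that bdd\<delta> by (intro cSUP_upper) auto
  have B\<Gamma>: "B \<le> \<Gamma>"
    using \<delta>[of 1] by (simp add: \<Gamma>_def)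
  have \<gamma>\<Gamma>: "\<gamma> k \<le> \<Gamma>" if "1 \<le> k" for k
    using \<delta>[OF that] \<beta>B[OF that] by (simp add: \<Gamma>_def)
  have B0: "0 \<le> B"
    using sup\<beta> by (simp add: B_def)
  then have "B\<^sup>2 < (sqrt (1 - \<nu>))\<^sup>2"
    using sup\<beta> by (intro power_strict_mono) (auto simp: B_def)
  then have \<omega>: "0 < \<omega>"
    using \<nu> by (simp add: \<omega>_def)
  \<comment> \<open>The second entry is the condition
    \<open>\<tau>1 * L * (\<Gamma> + 2) \<le> \<omega> / 4\<close> solved for
    \<open>\<tau>1\<close>.\<close>
  define T where "T = min 1 (\<omega> / (4 * (L * (\<Gamma> + 2))))"
  have LG: "0 < L * (\<Gamma> + 2)"
    using L B0 B\<Gamma> by simp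
  have T: "0 < T"
    using \<omega> LG by (simp add: T_def)
  define R where "R = \<rho> / (4 * (1 + \<Gamma>))"
  have R: "0 < R"
    using \<rho> B0 B\<Gamma> by (simp add: R_def)
  \<comment> \<open>Half of the budget \<open>\<omega> / 96 * R\<close> is reserved for the initial
    value of \<open>\<Phi>\<close>, the other half for the initial distance.\<close>
  have "0 < \<omega> / 96 * (R / 2)"
    using \<omega> R by simp
  then have "\<forall>\<^sub>F u in at_right 0. \<Phi> u < \<omega> / 96 * (R / 2)"
    using order_tendstoD(2)[OF \<Phi>_lim] by blast
  then obtain \<delta>0 where \<delta>0: "0 < \<delta>0" "\<And>u. 0 < u \<Longrightarrow> u < \<delta>0 \<Longrightarrow> \<Phi> u < \<omega> / 96 * (R / 2)"
    by (auto simp: eventually_at_right_field)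
  have "xbar \<in> X"
    using r by (simp add: X_def)
  then have "isCont f xbar"
    using gd by (auto simp: gderiv_def intro: has_derivative_continuous)
  then obtain d where d: "0 < d" "\<And>z. dist z xbar < d \<Longrightarrow> dist (f z) (f xbar) < min \<delta>0 \<eta>0"
    using \<delta>0 \<eta>0 unfolding continuous_at_eps_delta by (metis min_less_iff_conj)
  \<comment> \<open>\<open>R / 2\<close> limits the initial distance, and \<open>d\<close> keeps
    \<open>f (x 1) - f xbar\<close> below \<open>\<delta>0\<close> and \<open>\<eta>0\<close>. No
    stepsize enters, so one radius serves all admissible \<open>\<tau>1\<close> and
    \<open>\<tau>2\<close>.\<close>
  define \<xi> where "\<xi> = min r (min (R / 2) d)"
  have \<xi>: "\<xi> \<in> {0<..r}"
    using r R d by (simp add: \<xi>_def)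
  have run: "samm_run f g xbar \<rho> L \<nu> B \<Gamma> \<beta> \<gamma> \<tau>1 \<tau>2 x \<Phi> \<Phi>' \<eta>0"
    if \<tau>1: "\<tau>1 \<in> {0<..T}" and \<tau>2: "\<tau>2 \<in> {0..\<nu> / (L * (\<nu> + 1))}" and x1: "x 1 \<in> ball xbar \<xi>"
      and "samm_sequence g \<beta> \<gamma> \<tau>1 \<tau>2 x" and "\<forall>k\<ge>1. g (extrapolate \<gamma> x k) \<noteq> 0"
    for \<tau>1 \<tau>2 x
  proof
    show "\<tau>1 * L * (\<Gamma> + 2) \<le> (1 - \<nu> - B\<^sup>2) / 4"
    proof -
      have "\<tau>1 \<le> \<omega> / (4 * (L * (\<Gamma> + 2)))"
        using \<tau>1 by (simp add: T_def)
      then show ?thesis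
        using LG by (simp add: \<omega>_def field_simps)
    qed
    have n1: "norm (x 1 - xbar) < R / 2" "dist (x 1) xbar < d"
      using x1 by (auto simp: \<xi>_def dist_norm norm_minus_commute)
    show "norm (x 1 - xbar) < \<rho> / (4 * (1 + \<Gamma>))"
      unfolding R_def[symmetric] using n1 R by linarith
    show "f (x 1) - f xbar < \<eta>0 \<and>
        (1 - \<nu> - B\<^sup>2) / 96 * norm (x 1 - xbar) + \<Phi> (f (x 1) - f xbar)
        < (1 - \<nu> - B\<^sup>2) / 96 * (\<rho> / (4 * (1 + \<Gamma>)))"
      if gt: "f xbar < f (x 1)"
    proof -
      have "f (x 1) - f xbar < min \<delta>0 \<eta>0"
        using d(2)[OF n1(2)] unfolding dist_real_def by linarith
      moreover from this have "\<Phi> (f (x 1) - f xbar) < \<omega> / 96 * (R / 2)"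
        using gt by (intro \<delta>0) auto
      moreover have "\<omega> / 96 * norm (x 1 - xbar) < \<omega> / 96 * (R / 2)"
        using n1 \<omega> by (intro mult_strict_left_mono) auto
      ultimately show ?thesis
        unfolding \<omega>_def[symmetric] R_def[symmetric] by simp
    qed
    show "f xbar \<le> f z" if "z \<in> ball xbar \<rho>" for z
      using e(2) \<rho> that by blast
    show "GDERIV f z :> g z" if "z \<in> ball xbar \<rho>" for z
      using gd \<rho> that by blast
    show "norm (g u - g v) \<le> L * norm (u - v)" if "u \<in> ball xbar \<rho>" "v \<in> ball xbar \<rho>" for u v
      using lip \<rho> that by blast
    show "1 \<le> \<Phi>' (f z - f xbar + s) * (norm (g z) + 3 * sqrt s)"
      if "z \<in> ball xbar \<rho>" "f xbar \<le> f z" "0 \<le> s" "0 < f z - f xbar + s" "f z - f xbar + s < \<eta>0" for z s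
      using \<Phi>_grad \<rho>(3) that by blast
  qed (use that \<rho> L \<nu> B0 \<omega> B\<Gamma> \<beta>0 \<beta>B \<gamma>0 \<gamma>\<Gamma> \<Phi>_nonneg \<Phi>'_pos \<Phi>_tangent in \<open>auto simp: \<omega>_def T_def\<close>)
  show ?thesis
  proof (intro bexI[OF _ \<xi>] exI[of _ T] conjI T allI ballI impI)
    fix x :: "nat \<Rightarrow> real ^ 'n" and \<tau>1 \<tau>2
    assume "\<tau>1 \<in> {0<..T}" "\<tau>2 \<in> {0..\<nu> / (L * (\<nu> + 1))}" "x 1 \<in> ball xbar \<xi>"
      "samm_sequence g \<beta> \<gamma> \<tau>1 \<tau>2 x" "\<forall>k\<ge>1. g (extrapolate \<gamma> x k) \<noteq> 0"
    then interpret samm_run f g xbar \<rho> L \<nu> B \<Gamma> \<beta> \<gamma> \<tau>1 \<tau>2 x \<Phi> \<Phi>' \<eta>0 "1 - \<nu> - B\<^sup>2"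
      by (rule run) (rule reflexive)
    have rates: "(q = 1/2 \<longrightarrow>
             converges_linearly x xt \<and>
             converges_linearly (\<lambda>k. g (x k)) 0 \<and>
             converges_linearly (\<lambda>k. f (x k)) (f xt)) \<and>
          (1/2 < q \<longrightarrow>
             (\<lambda>k. norm (x k - xt)) \<in> O(\<lambda>k. real k powr (- ((1 - q) / (2 * q - 1)))) \<and>
             (\<lambda>k. norm (g (x k))) \<in> O(\<lambda>k. real k powr (- ((1 - q) / (2 * q - 1)))) \<and>
             (\<lambda>k. f (x k) - f xt) \<in> O(\<lambda>k. real k powr (- ((2 - 2 * q) / (2 * q - 1)))))"
      if M: "M > 0" and q: "q \<in> {0<..<1}"
        and pow: "\<forall>t. 0 \<le> t \<and> ereal t < \<eta> \<longrightarrow> \<psi> t = M * t powr (1 - q)" for M q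
    \<comment> \<open>For \<open>q < 1 / 2\<close> both rate claims are vacuous.\<close>
    proof (cases "1 / 2 \<le> q")
      case True
      then obtain C where C: "0 < C" "\<And>u. 0 < u \<Longrightarrow> u < \<eta>0 \<Longrightarrow> \<Phi> u \<le> C * u powr (1 - q)"
        "\<And>u. 0 < u \<Longrightarrow> u < \<eta>0 \<Longrightarrow> \<Phi>' u \<le> C * u powr (- q)"
        using \<Phi>_power[OF M _ _ pow] q by auto
      have "converges_linearly x xt \<and> converges_linearly (\<lambda>k. g (x k)) 0 \<and>
          converges_linearly (\<lambda>k. f (x k)) (f xt)" if "q = 1 / 2"
        using linear_rates[OF C[unfolded that]] by blast
      moreover have "(\<lambda>k. norm (x k - xt)) \<in> O(\<lambda>k. real k powr (- ((1 - q) / (2 * q - 1)))) \<and>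
          (\<lambda>k. norm (g (x k))) \<in> O(\<lambda>k. real k powr (- ((1 - q) / (2 * q - 1)))) \<and>
          (\<lambda>k. f (x k) - f xt) \<in> O(\<lambda>k. real k powr (- ((2 - 2 * q) / (2 * q - 1))))" if "1 / 2 < q"
        using sublinear_rates[OF C(1) that _ C(2,3)] q by auto
      ultimately show ?thesis by blast
    qed auto
    show "x k \<in> X" for k
      using iterates_in_ball \<rho>(2) by blast
    show "extrapolate \<beta> x k \<in> X" "extrapolate \<gamma> x k \<in> X" if "1 \<le> k" for k
      using extrapolates_in_ball[OF that] \<rho>(2) by auto
    have "xt \<in> X"
      using xt_in_ball \<rho>(2) by blast
    moreover have "extrapolate \<beta> x \<longlonglongrightarrow> xt" "extrapolate \<gamma> x \<longlonglongrightarrow> xt"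
      using extrapolate_tendsto \<beta>0 \<beta>B B\<Gamma> \<gamma>0 \<gamma>\<Gamma> order_trans by blast+
    ultimately show "\<exists>xt\<in>X. local_minimizer X f xt \<and> f xt = f xbar \<and>
        x \<longlonglongrightarrow> xt \<and>
        extrapolate \<beta> x \<longlonglongrightarrow> xt \<and>
        extrapolate \<gamma> x \<longlonglongrightarrow> xt \<and>
        (\<forall>M>0. \<forall>q\<in>{0<..<1}.
          (\<forall>t. 0 \<le> t \<and> ereal t < \<eta> \<longrightarrow> \<psi> t = M * t powr (1 - q)) \<longrightarrow>
          (q = 1/2 \<longrightarrow>
             converges_linearly x xt \<and>
             converges_linearly (\<lambda>k. g (x k)) 0 \<and>
             converges_linearly (\<lambda>k. f (x k)) (f xt)) \<and>
          (1/2 < q \<longrightarrow>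
             (\<lambda>k. norm (x k - xt)) \<in> O(\<lambda>k. real k powr (- ((1 - q) / (2 * q - 1)))) \<and>
             (\<lambda>k. norm (g (x k))) \<in> O(\<lambda>k. real k powr (- ((1 - q) / (2 * q - 1)))) \<and>
             (\<lambda>k. f (x k) - f xt) \<in> O(\<lambda>k. real k powr (- ((2 - 2 * q) / (2 * q - 1))))))"
      using xt_local_minimizer[OF \<rho>(2)] f_xt x_tendsto rates by (intro bexI[of _ xt]) blast+
  qed
qed

end
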